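(* Let $\mathbb{L}$ be a field of characteristic $p>0$ and $n\ge1$. For every $N\in\mathbb{N}$ and $\mu\in(0,1]$, the set $$\{\operatorname{fpt}(f):f\in W_{\preccurlyeq N}\}\cap(\mu,1]$$ is finite. In particular, this set of $F$-pure thresholds satisfies the ascending chain condition (it contains no strictly increasing infinite sequence).
   Context: For $\omega=(\omega_1,\dots,\omega_n)$ an $n$-tuple of positive integers, let $W_\omega$ be the set of (nonzero) polynomials $f\in\mathbb{L}[x_1,\dots,x_n]$ such that: (1) $\sqrt{\operatorname{Jac}(f)}=\mathfrak{m}=(x_1,\dots,x_n)$, where $\operatorname{Jac}(f)$ is the ideal generated by the partial derivatives of $f$; (2) $f$ is homogeneous under the grading determined by $(\deg x_1,\dots,\deg x_n)=\omega$ (field elements in degree $0$); (3) $p\nmid\deg f$. For $N\in\mathbb{N}$, $W_{\preccurlyeq N}=\bigcup_\omega W_\omega$, the union over all $\omega$ with $\omega_i\le N$ for each $1\le i\le n$. With $\mathfrak{m}^{[p^e]}=(x_1^{p^e},\dots,x_n^{p^e})$ and $f\in\mathfrak{m}$, set $\nu_f(p^e)=\max\{M:f^M\notin\mathfrak{m}^{[p^e]}\}$; the $F$-pure threshold is $\operatorname{fpt}(f)=\lim_{e\to\infty}\nu_f(p^e)/p^e$ (the limit exists). *)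

theory Defs
  imports Complex_Main "HOL-Library.Poly_Mapping"
begin

(* Polynomials over 'a in variables x_i, one for each i of the finite type 'n.  Multiplication
   on this type is convolution, so it is the polynomial ring. *)
type_synonym ('n, 'a) mpoly = "('n \<Rightarrow>\<^sub>0 nat) \<Rightarrow>\<^sub>0 'a"

definition Var :: "'n \<Rightarrow> ('n, 'a::comm_ring_1) mpoly" where
  "Var i = Poly_Mapping.single (Poly_Mapping.single i 1) 1"

definition mpderiv :: "'n \<Rightarrow> ('n, 'a::comm_ring_1) mpoly \<Rightarrow> ('n, 'a) mpoly" where
  "mpderiv i f = (\<Sum>m \<in> Poly_Mapping.keys f.
     Poly_Mapping.single (m - Poly_Mapping.single i 1)
       (of_nat (Poly_Mapping.lookup m i) * Poly_Mapping.lookup f m))"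

lemma lookup_mpderiv:
  "Poly_Mapping.lookup (mpderiv i f) m =
     of_nat (Poly_Mapping.lookup m i + 1) * Poly_Mapping.lookup f (m + Poly_Mapping.single i 1)" (is "_ = ?r")
proof -
  let ?s = "Poly_Mapping.single i (1::nat)"
  have "Poly_Mapping.lookup (mpderiv i f) m = (\<Sum>k\<in>Poly_Mapping.keys f. if k = m + ?s then ?r else 0)"
    unfolding mpderiv_def lookup_sum
  proof (rule sum.cong[OF refl])
    fix k
    show "Poly_Mapping.lookup (Poly_Mapping.single (k - ?s) (of_nat (Poly_Mapping.lookup k i) * Poly_Mapping.lookup f k)) m = (if k = m + ?s then ?r else 0)"
    proof (cases "Poly_Mapping.lookup k i = 0")
      case True then show ?thesis by (auto simp: lookup_add)
    next
      case False
      have "k - ?s = m \<longleftrightarrow> k = m + ?s"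
        using False by (auto simp: poly_mapping_eq_iff fun_eq_iff lookup_add lookup_minus lookup_single when_def)
      then show ?thesis by (auto simp: lookup_single lookup_add when_def)
    qed
  qed
  also have "\<dots> = ?r" by (auto simp: sum.delta' in_keys_iff)
  finally show ?thesis .
qed

lemma module_times: "module ((*) :: 'a::comm_ring_1 \<Rightarrow> 'a \<Rightarrow> 'a)"
  by unfold_locales (simp_all add: algebra_simps)

definition ideal_gen :: "'a::comm_ring_1 set \<Rightarrow> 'a set" where
  "ideal_gen S = module.span (*) S"

definition ideal_radical :: "'a::comm_ring_1 set \<Rightarrow> 'a set" where
  "ideal_radical I = {g. \<exists>k. g ^ k \<in> I}"

definition Jac :: "('n, 'a::comm_ring_1) mpoly \<Rightarrow> ('n, 'a) mpoly set" where
  "Jac f = ideal_gen (range (\<lambda>i. mpderiv i f))"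

definition max_ideal :: "('n, 'a::comm_ring_1) mpoly set" where
  "max_ideal = ideal_gen (range Var)"

text \<open>For \<open>q = p ^ e\<close> this is the Frobenius power of the homogeneous maximal ideal.\<close>
definition frob_power :: "nat \<Rightarrow> ('n, 'a::comm_ring_1) mpoly set" where
  "frob_power q = ideal_gen (range (\<lambda>i. Var i ^ q))"

definition wdeg :: "('n::finite \<Rightarrow> nat) \<Rightarrow> ('n \<Rightarrow>\<^sub>0 nat) \<Rightarrow> nat" where
  "wdeg \<omega> m = (\<Sum>i\<in>UNIV. \<omega> i * Poly_Mapping.lookup m i)"

definition whomogeneous ::
  "('n::finite \<Rightarrow> nat) \<Rightarrow> nat \<Rightarrow> ('n, 'a::comm_ring_1) mpoly \<Rightarrow> bool" where
  "whomogeneous \<omega> d f \<longleftrightarrow> (\<forall>m \<in> Poly_Mapping.keys f. wdeg \<omega> m = d)"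

text \<open>The degree \<open>d\<close> is unique because \<open>f \<noteq> 0\<close>.\<close>
definition W :: "('n::finite \<Rightarrow> nat) \<Rightarrow> ('n, 'a::field) mpoly set" where
  "W \<omega> = {f. f \<noteq> 0 \<and> ideal_radical (Jac f) = max_ideal \<and>
              (\<exists>d. whomogeneous \<omega> d f \<and> \<not> CHAR('a) dvd d)}"

definition W_upto :: "nat \<Rightarrow> ('n::finite, 'a::field) mpoly set" where
  "W_upto N = (\<Union>\<omega> \<in> {\<omega>. \<forall>i. 0 < \<omega> i \<and> \<omega> i \<le> N}. W \<omega>)"

text \<open>Only meaningful in positive characteristic and for \<open>f\<close> in the homogeneous maximal ideal,
  where the set is finite and contains \<open>0\<close>, and where the limit below exists.\<close>
definition nu :: "('n::finite, 'a::field) mpoly \<Rightarrow> nat \<Rightarrow> nat" where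
  "nu f e = Max {M. f ^ M \<notin> frob_power (CHAR('a) ^ e)}"

definition fpt :: "('n::finite, 'a::field) mpoly \<Rightarrow> real" where
  "fpt f = lim (\<lambda>e. real (nu f e) / real (CHAR('a) ^ e))"

end

theory Submission
  imports Defs "HOL-Computational_Algebra.Polynomial" "HOL-Computational_Algebra.Primes"
    "HOL-Library.Function_Algebras"
begin

text \<open>Fix weights \<open>\<omega>\<close> with sum \<open>\<sigma>\<close> and a degree \<open>d\<close> prime to the characteristic \<open>p\<close>, and put
\<open>\<nu>(e) = nu f e\<close>. Every monomial outside \<open>frob_power q\<close> has weighted degree at most \<open>(q - 1) \<sigma>\<close>, so
\<open>d \<nu>(e) \<le> (p\<^sup>e - 1) \<sigma>\<close> and \<open>fpt f \<le> \<sigma> / d\<close>. A lower bound \<open>\<mu>\<close> for the threshold therefore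
bounds \<open>d\<close>, and only finitely many pairs \<open>(\<omega>, d)\<close> matter. It remains to see that for fixed
\<open>(\<omega>, d)\<close> there are finitely many thresholds (\<open>finite_fpt_fixed_degree\<close>). The chain condition follows,
since thresholds lie in \<open>[0, 1]\<close> and the second term of a strictly increasing sequence is positive.

Suppose that \<open>Jac f\<close> contains all monomials of weighted degree at least \<open>t\<close>. If \<open>e > 0\<close> and \<open>p\<close>
does not divide \<open>\<nu>(e) + 1\<close>, then differentiating \<open>f\<^bsup>\<nu>(e)+1\<^esup> \<in> frob_power q\<close> with \<open>q = p\<^sup>e\<close> shows that
\<open>f\<^bsup>\<nu>(e)\<^esup>\<close> multiplies \<open>Jac f\<close> into \<open>frob_power q\<close>. Since the monomial complementary to a surviving
monomial of \<open>f\<^bsup>\<nu>(e)\<^esup>\<close> is not in \<open>Jac f\<close>, the gap \<open>(q - 1) \<sigma> - d \<nu>(e)\<close> is less than \<open>t\<close>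
(\<open>nu_degree_lower\<close>). If on the contrary \<open>p\<close> divides \<open>\<nu>(e) + 1\<close> for every \<open>e > M\<close>, then
\<open>\<nu>(e + 1) + 1 = p (\<nu>(e) + 1)\<close> from \<open>M\<close> on and \<open>fpt f = (\<nu>(M) + 1) / p\<^sup>M\<close>
(\<open>fpt_eq_if_divisible\<close>), which leaves finitely many values once \<open>M\<close> is fixed.

Choose \<open>e\<^sub>0 > 0\<close> with \<open>p\<^bsup>e\<^sub>0\<^esup> = 1\<close> modulo \<open>d\<close> and \<open>M = e\<^sub>0 + t\<close>. A gap below \<open>t\<close> at some \<open>e > M\<close> forces
\<open>\<sigma> \<le> d\<close>, and after division by \<open>p\<^bsup>e-e\<^sub>0\<^esup> > t\<close> and rounding it gives \<open>\<nu>(e\<^sub>0) + 1 \<ge> p\<^bsup>e\<^sub>0\<^esup> \<sigma> / d\<close>. So the gap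
at \<open>e\<^sub>0\<close> is at most \<open>d - \<sigma> < d\<close>; being a multiple of \<open>d\<close>, it is zero. Then \<open>f\<^bsup>\<nu>(e\<^sub>0)\<^esup>\<close> generates the socle of the quotient by the Frobenius power, the
products of its Frobenius powers again generate socles, and \<open>fpt f = \<sigma> / d\<close>
(\<open>fpt_eq_if_socle\<close>). So \<open>fpt f\<close> is \<open>\<sigma> / d\<close> or a fraction with denominator \<open>p\<^sup>M\<close> (\<open>fpt_cases\<close>).

The exponent \<open>M\<close> depends on \<open>t\<close>, so one \<open>t\<close> is needed for all \<open>f\<close> of the given degree
(\<open>uniform_monomials_in_Jac\<close>). For each \<open>t\<close>, containing all monomials of degree at least \<open>t\<close> is a Zariski
open condition on the coefficients of \<open>f\<close>, by Nakayama's lemma (\<open>monomials_in_Jac_open\<close>). These open sets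
grow with \<open>t\<close> and live in a finite-dimensional affine space, so by Hilbert's basis theorem they become
stationary.\<close>

section \<open>Noetherian subrings and the Hilbert basis theorem\<close>

text \<open>Subrings are sets, so that the coordinate functions can be adjoined one at a time inside one ring of functions.\<close>
definition subring_set :: "'a::comm_ring_1 set \<Rightarrow> bool" where
  "subring_set R \<longleftrightarrow> 1 \<in> R \<and> (\<forall>x\<in>R. \<forall>y\<in>R. x - y \<in> R \<and> x * y \<in> R)"

lemma subring_setD:
  assumes "subring_set R"
  shows "1 \<in> R" "0 \<in> R" "x \<in> R \<Longrightarrow> y \<in> R \<Longrightarrow> x - y \<in> R" "x \<in> R \<Longrightarrow> y \<in> R \<Longrightarrow> x * y \<in> R"
    "x \<in> R \<Longrightarrow> y \<in> R \<Longrightarrow> x + y \<in> R" "x \<in> R \<Longrightarrow> - x \<in> R"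
proof -
  have *: "\<And>x y. x \<in> R \<Longrightarrow> y \<in> R \<Longrightarrow> x - y \<in> R" and 1: "1 \<in> R"
    using assms by (auto simp: subring_set_def)
  then show 0: "0 \<in> R" by (metis diff_self)
  show "1 \<in> R" "x \<in> R \<Longrightarrow> y \<in> R \<Longrightarrow> x - y \<in> R" "x \<in> R \<Longrightarrow> y \<in> R \<Longrightarrow> x * y \<in> R"
    using assms by (auto simp: subring_set_def)
  show "x \<in> R \<Longrightarrow> - x \<in> R" using *[OF 0, of x] by simp
  then have "\<And>y. y \<in> R \<Longrightarrow> - y \<in> R" using *[OF 0] by fastforce
  then show "x \<in> R \<Longrightarrow> y \<in> R \<Longrightarrow> x + y \<in> R" using *[of x "- y"] by simp
qed

lemma subring_set_sum:
  assumes "subring_set R" "\<And>i. i \<in> I \<Longrightarrow> f i \<in> R"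
  shows "sum f I \<in> R"
  using assms(2) by (induction I rule: infinite_finite_induct) (auto simp: subring_setD[OF assms(1)])

inductive_set lincomb :: "'a::comm_ring_1 set \<Rightarrow> 'a set \<Rightarrow> 'a set" for R A where
  zero: "0 \<in> lincomb R A"
| step: "r \<in> R \<Longrightarrow> a \<in> A \<Longrightarrow> x \<in> lincomb R A \<Longrightarrow> r * a + x \<in> lincomb R A"

lemma lincomb_add: "x \<in> lincomb R A \<Longrightarrow> y \<in> lincomb R A \<Longrightarrow> x + y \<in> lincomb R A"
  by (induction rule: lincomb.induct) (auto simp: add.assoc intro: lincomb.intros)

lemma lincomb_mult:
  assumes "subring_set R" "r \<in> R" "x \<in> lincomb R A"
  shows "r * x \<in> lincomb R A"
  using assms(3)
proof (induction rule: lincomb.induct)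
  case (step s a x)
  have "(r * s) * a + r * x \<in> lincomb R A"
    using step assms by (intro lincomb.step) (auto simp: subring_setD)
  then show ?case by (simp add: algebra_simps)
qed (simp add: lincomb.zero)

lemma lincomb_diff:
  assumes "subring_set R" "x \<in> lincomb R A" "y \<in> lincomb R A"
  shows "x - y \<in> lincomb R A"
  using lincomb_add[OF assms(2) lincomb_mult[OF assms(1) _ assms(3), of "- 1"]] 
  by (simp add: subring_setD[OF assms(1)])

lemma lincomb_base: "subring_set R \<Longrightarrow> a \<in> A \<Longrightarrow> a \<in> lincomb R A"
  using lincomb.step[of 1 R a A 0] by (simp add: subring_setD lincomb.zero)

lemma lincomb_trans:
  assumes "subring_set R" "x \<in> lincomb R A" "A \<subseteq> lincomb R B"
  shows "x \<in> lincomb R B"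
  using assms(2)
  by (induction rule: lincomb.induct)
     (use assms in \<open>auto intro!: lincomb.zero lincomb_add lincomb_mult\<close>)

lemma lincomb_mono: "x \<in> lincomb R A \<Longrightarrow> A \<subseteq> B \<Longrightarrow> x \<in> lincomb R B"
  by (induction rule: lincomb.induct) (auto intro: lincomb.intros)

lemma lincomb_range_finite:
  assumes "x \<in> lincomb R (range p)"
  shows "\<exists>k. x \<in> lincomb R (p ` {..<k::nat})"
  using assms
proof (induction rule: lincomb.induct)
  case (step r a x)
  then obtain i k where "a = p i" "x \<in> lincomb R (p ` {..<k})" by auto
  then have "r * a + x \<in> lincomb R (p ` {..<max k (Suc i)})"
    using step by (intro lincomb.step) (auto intro: lincomb_mono)
  then show ?case by blast
qed (auto intro: lincomb.zero)

text \<open>The ascending chain condition for the ideals generated by initial segments of a sequence. This form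
transfers directly along surjective ring homomorphisms and is the one used for zero sets below.\<close>
definition noeth :: "'a::comm_ring_1 set \<Rightarrow> bool" where
  "noeth R \<longleftrightarrow> (\<forall>a. range a \<subseteq> R \<longrightarrow> (\<exists>k::nat. a k \<in> lincomb R (a ` {..<k})))"

definition polys_over :: "'a::comm_ring_1 set \<Rightarrow> 'a poly set" where
  "polys_over R = {p. \<forall>i. coeff p i \<in> R}"

lemma subring_polys_over: "subring_set R \<Longrightarrow> subring_set (polys_over R)"
  unfolding subring_set_def[of "polys_over R"]
  by (auto simp: polys_over_def coeff_mult subring_setD intro!: subring_set_sum)

lemma monom_polys_over: "subring_set R \<Longrightarrow> r \<in> R \<Longrightarrow> monom r n \<in> polys_over R"
  by (auto simp: polys_over_def coeff_monom subring_setD)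

text \<open>Multiplying each generator by a power of the variable to bring its degree up to \<open>n\<close> turns a combination of
leading coefficients into a polynomial combination that has this combination as its coefficient at \<open>n\<close>.\<close>
lemma lincomb_lead_coeffs:
  assumes R: "subring_set R" and F: "\<And>f. f \<in> F \<Longrightarrow> degree f \<le> n"
    and x: "x \<in> lincomb R (lead_coeff ` F)"
  shows "\<exists>g\<in>lincomb (polys_over R) F. degree g \<le> n \<and> coeff g n = x"
  using x
proof (induction rule: lincomb.induct)
  case zero
  then show ?case by (intro bexI[of _ 0]) (auto intro: lincomb.zero)
next
  case (step r a x)
  then obtain f g where f: "f \<in> F" "a = lead_coeff f" 
    and g: "g \<in> lincomb (polys_over R) F" "degree g \<le> n" "coeff g n = x" by auto
  let ?s = "monom r (n - degree f)"
  have "degree (?s * f) \<le> (n - degree f) + degree f"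
    using degree_mult_le[of ?s f] degree_monom_le[of r "n - degree f"] by linarith
  then have "degree (?s * f) \<le> n" using F[OF f(1)] by simp
  moreover have "coeff (?s * f) n = r * a"
    using F[OF f(1)] f(2) by (simp add: coeff_monom_mult)
  ultimately show ?case
    using f g step(1) by (intro bexI[of _ "?s * f + g"] lincomb.step)
       (auto intro: degree_add_le monom_polys_over[OF R])
qed

text \<open>Given a sequence that violates the condition, form another one from the ideal \<open>I\<close> that it generates, each
member having least degree in \<open>I\<close> outside the ideal of its predecessors. A relation among the leading coefficients
would then produce an element of smaller degree.\<close>
theorem Hilbert_basis:
  assumes R: "subring_set R" and noeth: "noeth R"
  shows "noeth (polys_over R)"
  unfolding noeth_def
proof (intro allI impI)
  fix p :: "nat \<Rightarrow> 'a poly"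
  let ?S = "polys_over R"
  assume p: "range p \<subseteq> ?S"
  have S: "subring_set ?S" by (rule subring_polys_over[OF R])
  show "\<exists>k. p k \<in> lincomb ?S (p ` {..<k})"
  proof (rule ccontr)
    assume nex: "\<not> ?thesis"
    define I where "I = lincomb ?S (range p)"
    have IS: "x \<in> ?S" if "x \<in> I" for x
      using that unfolding I_def
      by (induction rule: lincomb.induct) (use p in \<open>auto simp: subring_setD[OF S]\<close>)
    have not_fg: "\<exists>g\<in>I. g \<notin> lincomb ?S F" if "finite F" "F \<subseteq> I" for F
    proof -
      have "\<exists>k. F \<subseteq> lincomb ?S (p ` {..<k})"
        using that
      proof (induction F rule: finite_induct)
        case (insert x F)
        then obtain k l where "F \<subseteq> lincomb ?S (p ` {..<k})" "x \<in> lincomb ?S (p ` {..<l})"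
          using lincomb_range_finite[of x ?S p] unfolding I_def by auto
        then have "insert x F \<subseteq> lincomb ?S (p ` {..<max k l})"
          by (auto elim!: lincomb_mono dest: subsetD)
        then show ?case by blast
      qed auto
      then obtain k where "F \<subseteq> lincomb ?S (p ` {..<k})" by blast
      then have "p k \<notin> lincomb ?S F" using nex lincomb_trans[OF S] by blast
      moreover have "p k \<in> I" unfolding I_def by (rule lincomb_base[OF S]) auto
      ultimately show ?thesis by blast
    qed
    \<comment> \<open>\<open>P f k r\<close>: an admissible choice of \<open>f k = r\<close> when \<open>f i\<close> is already chosen for \<open>i < k\<close>.\<close>
    define P where "P f k r \<longleftrightarrow> r \<in> I \<and> r \<notin> lincomb ?S (f ` {..<k}) \<and>
       (\<forall>g\<in>I. g \<notin> lincomb ?S (f ` {..<k}) \<longrightarrow> degree r \<le> degree g)" for f :: "nat \<Rightarrow> 'a poly" and k r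
    have "\<exists>f. \<forall>k. P f k (f k)"
    proof (rule dependent_wellorder_choice)
      show "P f x r = P g x r" if "\<And>y. y < x \<Longrightarrow> f y = g y" for r f g x
      proof -
        have "f ` {..<x} = g ` {..<x}" using that by (intro image_cong) auto
        then show ?thesis by (simp add: P_def)
      qed
      show "\<exists>r. P f x r" if *: "\<And>y. y < x \<Longrightarrow> P f y (f y)" for x f
      proof -
        have "\<exists>g. g \<in> I \<and> g \<notin> lincomb ?S (f ` {..<x})"
          using not_fg[of "f ` {..<x}"] * by (auto simp: P_def)
        then show ?thesis
          unfolding P_def 
          using ex_has_least_nat[of "\<lambda>g. g \<in> I \<and> g \<notin> lincomb ?S (f ` {..<x})" _ degree] by blast
      qed
    qed
    then obtain f where f: "\<And>k. P f k (f k)" by blast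
    have "range (\<lambda>k. lead_coeff (f k)) \<subseteq> R"
      using f IS by (fastforce simp: P_def polys_over_def)
    then obtain k where k: "lead_coeff (f k) \<in> lincomb R ((\<lambda>k. lead_coeff (f k)) ` {..<k})"
      using noeth unfolding noeth_def by blast
    have deg: "degree g \<le> degree (f k)" if "g \<in> f ` {..<k}" for g
    proof -
      from that obtain i where i: "i < k" "g = f i" by auto
      have "f k \<notin> lincomb ?S (f ` {..<i})"
        using f[of k] i lincomb_mono[of "f k" ?S "f ` {..<i}" "f ` {..<k}"] 
        by (auto simp: P_def image_mono)
      then show ?thesis using f[of i] f[of k] i by (auto simp: P_def)
    qed
    have "lead_coeff (f k) \<in> lincomb R (lead_coeff ` f ` {..<k})"
      using k by (simp add: image_image)
    from lincomb_lead_coeffs[OF R deg this] obtain g where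
      g: "g \<in> lincomb ?S (f ` {..<k})" "degree g \<le> degree (f k)" "coeff g (degree (f k)) = lead_coeff (f k)"
      by auto
    have fk: "f k \<in> I" "f k \<notin> lincomb ?S (f ` {..<k})" using f[of k] by (auto simp: P_def)
    have notin: "f k - g \<notin> lincomb ?S (f ` {..<k})"
      using fk(2) lincomb_add[OF _ g(1), of "f k - g"] by auto
    have "f ` {..<k} \<subseteq> I" using f by (auto simp: P_def)
    then have "g \<in> I" using g(1) lincomb_trans[OF S] unfolding I_def by blast
    then have "f k - g \<in> I" using fk(1) lincomb_diff[OF S] unfolding I_def by blast
    then have "degree (f k) \<le> degree (f k - g)"
      using notin f[of k] by (auto simp: P_def)
    moreover have "degree (f k - g) \<le> degree (f k)"
      using g(2) by (intro degree_diff_le) auto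
    ultimately have "lead_coeff (f k - g) = 0" using g(3) by simp
    then have "f k - g = 0" by (simp only: leading_coeff_0_iff)
    then show False using notin lincomb.zero by metis
  qed
qed

definition adjoin :: "'a::comm_ring_1 set \<Rightarrow> 'a \<Rightarrow> 'a set" where
  "adjoin R y = (\<lambda>p. poly p y) ` polys_over R"

lemma subring_adjoin: 
  assumes "subring_set R" shows "subring_set (adjoin R y)"
proof -
  note S = subring_setD[OF subring_polys_over[OF assms]]
  have "1 \<in> adjoin R y" unfolding adjoin_def using S(1) by (force intro: rev_image_eqI)
  then show ?thesis
    unfolding subring_set_def
    by (auto simp: adjoin_def simp flip: poly_diff poly_mult intro!: imageI S)
qed

lemma adjoin_superset: "subring_set R \<Longrightarrow> R \<subseteq> adjoin R y"
proof
  fix r assume "subring_set R" "r \<in> R"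
  then show "r \<in> adjoin R y" unfolding adjoin_def 
    by (intro rev_image_eqI[of "monom r 0"] monom_polys_over) (auto simp: poly_monom)
qed

lemma adjoin_gen: "subring_set R \<Longrightarrow> y \<in> adjoin R y"
  unfolding adjoin_def
  by (intro rev_image_eqI[of "monom 1 1"] monom_polys_over) (auto simp: poly_monom subring_setD)

text \<open>Evaluation at \<open>y\<close> maps \<open>polys_over R\<close> onto \<open>adjoin R y\<close>; in particular \<open>y\<close> may be algebraic over \<open>R\<close>.\<close>
lemma noeth_adjoin:
  assumes "subring_set R" "noeth R" shows "noeth (adjoin R y)"
  unfolding noeth_def
proof (intro allI impI)
  fix a :: "nat \<Rightarrow> 'a" assume "range a \<subseteq> adjoin R y"
  then have "\<forall>k. \<exists>p\<in>polys_over R. a k = poly p y" by (auto simp: adjoin_def)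
  then obtain p where p: "\<And>k. p k \<in> polys_over R" "\<And>k. a k = poly (p k) y" by metis
  then obtain k where k: "p k \<in> lincomb (polys_over R) (p ` {..<k})"
    using Hilbert_basis[OF assms] unfolding noeth_def by blast
  have "poly q y \<in> lincomb (adjoin R y) (a ` {..<k})" 
    if "q \<in> lincomb (polys_over R) (p ` {..<k})" for q
    using that
    by (induction rule: lincomb.induct) (auto simp: p adjoin_def intro!: lincomb.intros)
  then show "\<exists>k. a k \<in> lincomb (adjoin R y) (a ` {..<k})" using k p(2) by auto
qed

lemma finite_adjoin_noeth:
  assumes R: "subring_set R" "noeth R" and "finite Y"
  shows "\<exists>A. subring_set A \<and> noeth A \<and> R \<subseteq> A \<and> Y \<subseteq> A"
  using \<open>finite Y\<close>
proof (induction Y rule: finite_induct)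
  case empty then show ?case using R by blast
next
  case (insert y Y)
  then obtain A where A: "subring_set A" "noeth A" "R \<subseteq> A" "Y \<subseteq> A" by blast
  show ?case
    using subring_adjoin[OF A(1), of y] noeth_adjoin[OF A(1,2), of y] 
      adjoin_superset[OF A(1), of y] adjoin_gen[OF A(1), of y] A by blast
qed

definition const_funs :: "('x \<Rightarrow> 'k::field) set" where
  "const_funs = range (\<lambda>c x. c)"

lemma subring_const_funs: "subring_set (const_funs :: ('x \<Rightarrow> 'k::field) set)"
  unfolding subring_set_def const_funs_def
  by (auto simp: fun_eq_iff)

lemma noeth_const_funs: "noeth (const_funs :: ('x \<Rightarrow> 'k::field) set)"
  unfolding noeth_def
proof (intro allI impI)
  fix a :: "nat \<Rightarrow> 'x \<Rightarrow> 'k" 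
  let ?K = "const_funs :: ('x \<Rightarrow> 'k) set"
  assume "range a \<subseteq> ?K"
  then have "\<forall>k. \<exists>c. a k = (\<lambda>x. c)" by (auto simp: const_funs_def image_iff)
  then obtain c where c: "\<And>k. a k = (\<lambda>x. c k)" by metis
  show "\<exists>k. a k \<in> lincomb ?K (a ` {..<k})"
  proof (cases "c 0 = 0")
    case True
    then have "a 0 = 0" using c by auto
    then have "a 0 \<in> lincomb ?K (a ` {..<0})" by (metis lincomb.zero)
    then show ?thesis by blast
  next
    case False
    have "(\<lambda>x. c 1 / c 0) * a 0 + 0 \<in> lincomb ?K (a ` {..<1})"
      by (intro lincomb.intros) (auto simp: const_funs_def)
    moreover have "(\<lambda>x. c 1 / c 0) * a 0 + 0 = a 1" using False c by (auto simp: fun_eq_iff)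
    ultimately show ?thesis by metis
  qed
qed

text \<open>Zariski closed sets satisfy the descending chain condition: if the points \<open>x j\<close> were common zeros of all
\<open>h i\<close> with \<open>i < j\<close>, then an \<open>h j\<close> in the ideal of its predecessors would vanish at \<open>x j\<close>.\<close>
lemma noeth_zero_sets:
  assumes A: "noeth A" and h: "\<And>j. h j \<in> A"
    and nz: "\<And>j. h j (x j) \<noteq> (0::'k::comm_ring_1)"
  shows "\<exists>i j. i < (j::nat) \<and> h i (x j) \<noteq> 0"
proof (rule ccontr)
  assume *: "\<not> ?thesis"
  from A h obtain k where k: "h k \<in> lincomb A (h ` {..<k})" unfolding noeth_def by blast
  have "g (x k) = 0" if "g \<in> lincomb A (h ` {..<k})" for g
    using that by (induction rule: lincomb.induct) (use * in auto)
  then show False using k nz by blast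
qed

section \<open>Nakayama's lemma for families of vector spaces\<close>

context vector_space
begin

text \<open>The points \<open>x\<close> are parameters. At \<open>x0\<close> the relations say that a nonzero multiple of each \<open>e s\<close> lies in \<open>V\<close>; the
conclusion is that the relations force \<open>e s \<in> V\<close> on the whole Zariski neighbourhood \<open>h \<noteq> 0\<close> of \<open>x0\<close>. The vectors are
eliminated one by one. The factors \<open>a s\<close> make the statement stable under elimination without
division: the pivot \<open>a r - p r r\<close> is nonzero at \<open>x0\<close>, and \<open>h\<close> is the product of the pivots.\<close>
lemma Nakayama_elimination:
  assumes R: "subring_set (R :: ('x \<Rightarrow> 'a) set)" and "finite I"
  shows "(\<And>s. s \<in> I \<Longrightarrow> a s \<in> R \<and> a s x0 \<noteq> 0) \<Longrightarrow>
    (\<And>s u. s \<in> I \<Longrightarrow> u \<in> I \<Longrightarrow> p s u \<in> R \<and> p s u x0 = 0) \<Longrightarrow>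
    \<exists>h\<in>R. h x0 \<noteq> 0 \<and> (\<forall>x V e. h x \<noteq> 0 \<longrightarrow> subspace V \<longrightarrow>
      (\<forall>s\<in>I. scale (a s x) (e s) - (\<Sum>u\<in>I. scale (p s u x) (e u)) \<in> V) \<longrightarrow> (\<forall>s\<in>I. e s \<in> V))"
  using \<open>finite I\<close>
proof (induction I arbitrary: a p rule: finite_induct)
  case empty
  show ?case by (intro bexI[of _ 1]) (auto simp: subring_setD[OF R])
next
  case (insert r I)
  note closed = subring_setD[OF R]
  define b where "b = a r - p r r"
  define a' where "a' s = b * a s" for s
  define p' where "p' s u = b * p s u + p s r * p r u" for s u
  have bR: "b \<in> R" "b x0 \<noteq> 0" using insert.prems by (auto simp: b_def closed)
  have 1: "a' s \<in> R \<and> a' s x0 \<noteq> 0" if "s \<in> I" for s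
    using insert.prems(1)[of s] that bR by (auto simp: a'_def closed)
  have 2: "p' s u \<in> R \<and> p' s u x0 = 0" if "s \<in> I" "u \<in> I" for s u
    using insert.prems(2) that bR by (auto simp: p'_def closed)
  obtain h where h: "h \<in> R" "h x0 \<noteq> 0" and 
    hV: "\<And>x V e. h x \<noteq> 0 \<Longrightarrow> subspace V \<Longrightarrow>
      (\<forall>s\<in>I. scale (a' s x) (e s) - (\<Sum>u\<in>I. scale (p' s u x) (e u)) \<in> V) \<Longrightarrow> (\<forall>s\<in>I. e s \<in> V)"
    using insert.IH[of a' p', OF 1 2] by blast
  show ?case
  proof (intro bexI[of _ "h * b"] conjI allI impI)
    show "h * b \<in> R" "(h * b) x0 \<noteq> 0" using h bR by (auto simp: closed)
    fix x V e
    assume "(h * b) x \<noteq> 0" and V: "subspace V"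
      and eq: "\<forall>s\<in>insert r I. scale (a s x) (e s) - (\<Sum>u\<in>insert r I. scale (p s u x) (e u)) \<in> V"
    then have hx: "h x \<noteq> 0" "b x \<noteq> 0" by auto
    have er: "scale (b x) (e r) - (\<Sum>u\<in>I. scale (p r u x) (e u)) \<in> V" (is "?er \<in> V")
      using eq insert.hyps by (auto simp: b_def algebra_simps)
    have "\<forall>s\<in>I. e s \<in> V"
    proof (rule hV[OF hx(1) V], rule ballI)
      fix s assume s: "s \<in> I"
      have es: "scale (a s x) (e s) - scale (p s r x) (e r) - (\<Sum>u\<in>I. scale (p s u x) (e u)) \<in> V"
        (is "?es \<in> V")
        using eq s insert.hyps by (auto simp: algebra_simps)
      have "scale (a' s x) (e s) - (\<Sum>u\<in>I. scale (p' s u x) (e u)) = 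
         scale (b x) ?es + scale (p s r x) ?er"
        by (simp add: a'_def p'_def algebra_simps sum.distrib scale_sum_right)
      then show "scale (a' s x) (e s) - (\<Sum>u\<in>I. scale (p' s u x) (e u)) \<in> V"
        using es er V by (simp add: subspace_add subspace_scale)
    qed
    moreover have "e r \<in> V"
    proof -
      have "(\<Sum>u\<in>I. scale (p r u x) (e u)) \<in> V"
        using calculation V by (intro subspace_sum subspace_scale) auto
      then have "?er + (\<Sum>u\<in>I. scale (p r u x) (e u)) \<in> V"
        using er V by (intro subspace_add)
      then have "scale (b x) (e r) \<in> V" by (simp only: diff_add_cancel)
      then have "scale (1 / b x) (scale (b x) (e r)) \<in> V"
        by (rule subspace_scale[OF V])
      then show ?thesis using hx by simp
    qed
    ultimately show "\<forall>s\<in>insert r I. e s \<in> V" by blast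
  qed
qed

end

section \<open>Monomials and ideals in the polynomial ring\<close>

abbreviation (input) "lookup \<equiv> Poly_Mapping.lookup"
abbreviation (input) "keys \<equiv> Poly_Mapping.keys"
abbreviation (input) "single \<equiv> Poly_Mapping.single"

lemma poly_mapping_expand: "f = (\<Sum>m\<in>keys f. single m (lookup f m))"
  by (rule poly_mapping_eqI) (auto simp: lookup_sum lookup_single when_def in_keys_iff)

lemma lookup_single_mult:
  fixes a :: "'m::cancel_comm_monoid_add" and g :: "'m \<Rightarrow>\<^sub>0 'a::comm_ring_1"
  shows "lookup (single a c * g) (a + m) = c * lookup g m"
proof -
  have "single a c * g = (\<Sum>k\<in>keys g. single (a + k) (c * lookup g k))"
    by (subst poly_mapping_expand[of g]) (simp add: sum_distrib_left mult_single)
  then show ?thesis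
    by (auto simp: lookup_sum lookup_single when_def in_keys_iff)
qed

lemma lookup_single_mult_notin:
  assumes "\<And>m. u \<noteq> a + m"
  shows "lookup (single a c * g :: 'm::comm_monoid_add \<Rightarrow>\<^sub>0 'a::comm_ring_1) u = 0"
proof (rule ccontr)
  assume "\<not> ?thesis"
  then have "u \<in> keys (single a c * g)" by (simp add: in_keys_iff)
  then obtain x y where "u = x + y" "x \<in> keys (single a c)" using keys_mult by blast
  then show False using assms by (auto split: if_splits)
qed

lemma lookup_scale: "lookup (single 0 c * g :: 'm::cancel_comm_monoid_add \<Rightarrow>\<^sub>0 'a::comm_ring_1) m = c * lookup g m"
  using lookup_single_mult[of 0 c g m] by simp

interpretation mpoly_vs: vector_space "\<lambda>c (f :: 'm::cancel_comm_monoid_add \<Rightarrow>\<^sub>0 'a::field). single 0 c * f"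
  by unfold_locales (auto intro!: poly_mapping_eqI simp: lookup_scale lookup_add mult_single[of 0 _ 0, simplified, symmetric] distrib_left
      distrib_right single_add mult.assoc)

lemma ideal_gen_base: "a \<in> S \<Longrightarrow> a \<in> ideal_gen S"
  unfolding ideal_gen_def by (rule module.span_base[OF module_times])

lemma ideal_gen_zero: "0 \<in> ideal_gen S"
  unfolding ideal_gen_def by (rule module.span_zero[OF module_times])

lemma ideal_gen_add: "a \<in> ideal_gen S \<Longrightarrow> b \<in> ideal_gen S \<Longrightarrow> a + b \<in> ideal_gen S"
  unfolding ideal_gen_def by (rule module.span_add[OF module_times])

lemma ideal_gen_mult: "a \<in> ideal_gen S \<Longrightarrow> r * a \<in> ideal_gen S"
  unfolding ideal_gen_def by (rule module.span_scale[OF module_times])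

lemma ideal_gen_sum: "(\<And>i. i \<in> I \<Longrightarrow> f i \<in> ideal_gen S) \<Longrightarrow> sum f I \<in> ideal_gen S"
  unfolding ideal_gen_def by (rule module.span_sum[OF module_times])

lemma ideal_gen_minimal:
  assumes "x \<in> ideal_gen S" "S \<subseteq> J" "0 \<in> J" "\<And>a b. a \<in> J \<Longrightarrow> b \<in> J \<Longrightarrow> a + b \<in> J" "\<And>r a. a \<in> J \<Longrightarrow> r * a \<in> J"
  shows "x \<in> J"
proof -
  have "module.subspace (*) J" using assms by (auto simp: module.subspace_def[OF module_times])
  then show ?thesis using module.span_minimal[OF module_times assms(2)] assms(1) by (auto simp: ideal_gen_def)
qed

lemma ideal_gen_range_finite:
  fixes g :: "'i::finite \<Rightarrow> 'a::comm_ring_1"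
  assumes "x \<in> ideal_gen (range g)"
  shows "\<exists>q. x = (\<Sum>j\<in>UNIV. q j * g j)"
proof -
  have "x \<in> {x. \<exists>q. x = (\<Sum>j\<in>UNIV. q j * g j)}"
  proof (rule ideal_gen_minimal[OF assms])
    show "range g \<subseteq> {x. \<exists>q. x = (\<Sum>j\<in>UNIV. q j * g j)}"
    proof safe
      fix i
      have "g i = (\<Sum>j\<in>UNIV. (if j = i then 1 else 0) * g j)"
        by (subst sum.cong[OF refl, of _ _ "\<lambda>j. if j = i then g j else 0"]) auto
      then show "\<exists>q. g i = (\<Sum>j\<in>UNIV. q j * g j)" by (intro exI[of _ "\<lambda>j. if j = i then 1 else 0"])
    qed
    show "0 \<in> {x. \<exists>q. x = (\<Sum>j\<in>UNIV. q j * g j)}" by (auto intro!: exI[of _ "\<lambda>_. 0"])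
    show "a + b \<in> {x. \<exists>q. x = (\<Sum>j\<in>UNIV. q j * g j)}" if "a \<in> {x. \<exists>q. x = (\<Sum>j\<in>UNIV. q j * g j)}"
      "b \<in> {x. \<exists>q. x = (\<Sum>j\<in>UNIV. q j * g j)}" for a b
    proof -
      from that obtain q r where "a = (\<Sum>j\<in>UNIV. q j * g j)" "b = (\<Sum>j\<in>UNIV. r j * g j)" by auto
      then have "a + b = (\<Sum>j\<in>UNIV. (q j + r j) * g j)" by (simp add: algebra_simps sum.distrib)
      then show ?thesis by (auto intro: exI[of _ "\<lambda>j. q j + r j"])
    qed
    show "r * a \<in> {x. \<exists>q. x = (\<Sum>j\<in>UNIV. q j * g j)}" if "a \<in> {x. \<exists>q. x = (\<Sum>j\<in>UNIV. q j * g j)}" for r a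
    proof -
      from that obtain q where "a = (\<Sum>j\<in>UNIV. q j * g j)" by auto
      then have "r * a = (\<Sum>j\<in>UNIV. (r * q j) * g j)" by (simp add: algebra_simps sum_distrib_left)
      then show ?thesis by (auto intro: exI[of _ "\<lambda>j. r * q j"])
    qed
  qed
  then show ?thesis by simp
qed

lemma Var_power: "Var i ^ k = single (single i k) 1"
  by (induction k) (simp_all add: Var_def mult_single single_add[symmetric])

lemma wdeg_add: "wdeg \<omega> (a + b) = wdeg \<omega> a + wdeg \<omega> b"
  by (simp add: wdeg_def lookup_add algebra_simps sum.distrib)

lemma wdeg_single: "wdeg \<omega> (single i k) = \<omega> i * k"
  unfolding wdeg_def
  by (subst sum.cong[OF refl, of _ _ "\<lambda>j. if j = i then \<omega> j * k else 0"]) (auto simp: lookup_single when_def)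

lemma monomial_split:
  fixes m :: "'n \<Rightarrow>\<^sub>0 nat"
  assumes "k \<le> lookup m i"
  shows "m = single i k + (m - single i k)"
  by (rule poly_mapping_eqI) (use assms in \<open>auto simp: lookup_add lookup_minus lookup_single when_def\<close>)

lemma finite_wdeg_le:
  fixes \<omega> :: "'n::finite \<Rightarrow> nat"
  assumes "\<And>i. 0 < \<omega> i"
  shows "finite {m. wdeg \<omega> m \<le> D}"
proof -
  have "lookup m i \<le> D" if "wdeg \<omega> m \<le> D" for m i
  proof -
    have "1 * lookup m i \<le> \<omega> i * lookup m i" using assms[of i] by (intro mult_right_mono) auto
    also have "\<dots> \<le> wdeg \<omega> m" unfolding wdeg_def by (rule member_le_sum) auto
    finally show ?thesis using that by simp
  qed
  then have "lookup ` {m. wdeg \<omega> m \<le> D} \<subseteq>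
      {f. \<forall>x. (x \<in> UNIV \<longrightarrow> f x \<in> {..D}) \<and> (x \<notin> UNIV \<longrightarrow> f x = 0)}" by auto
  then have "finite (lookup ` {m. wdeg \<omega> m \<le> D})"
    by (rule finite_subset) (rule finite_set_of_finite_funs, auto)
  then show ?thesis
    by (rule finite_imageD) (auto intro!: inj_onI poly_mapping_eqI)
qed

section \<open>A uniform degree bound for the Jacobian ideal\<close>

definition monomials_in_Jac :: "('n::finite \<Rightarrow> nat) \<Rightarrow> nat \<Rightarrow> ('n, 'a::comm_ring_1) mpoly \<Rightarrow> bool" where
  "monomials_in_Jac \<omega> t f \<longleftrightarrow> (\<forall>m. t \<le> wdeg \<omega> m \<longrightarrow> single m 1 \<in> Jac f)"

text \<open>The weights are at most \<open>N\<close>, so a monomial of degree at least \<open>t + N\<close> stays above degree \<open>t\<close> after removing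
one variable. This reduces the infinitely many conditions to finitely many.\<close>
lemma monomials_in_Jac_window:
  assumes "\<And>i. 0 < \<omega> i \<and> \<omega> i \<le> N"
    and win: "\<And>m. t \<le> wdeg \<omega> m \<Longrightarrow> wdeg \<omega> m < t + N \<Longrightarrow> single m 1 \<in> Jac f"
  shows "monomials_in_Jac \<omega> t f"
proof -
  have "single m 1 \<in> Jac f" if "t \<le> wdeg \<omega> m" for m
    using that
  proof (induction "wdeg \<omega> m" arbitrary: m rule: less_induct)
    case less
    show ?case
    proof (cases "wdeg \<omega> m < t + N")
      case True then show ?thesis using win less by blast
    next
      case False
      then have "m \<noteq> 0" using assms(1) by (auto simp: wdeg_def) (metis less_le_trans not_less_zero)
      then obtain i where i: "lookup m i \<ge> 1" 
        by (metis One_nat_def Suc_leI lookup_zero not_gr_zero poly_mapping_eqI)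
      define m' where "m' = m - single i 1"
      have m: "m = single i 1 + m'" unfolding m'_def using monomial_split[OF i] .
      then have w: "wdeg \<omega> m = \<omega> i + wdeg \<omega> m'" by (simp add: wdeg_add wdeg_single)
      then have "single m' 1 \<in> Jac f" using less.hyps[of m'] assms(1)[of i] False by auto
      then have "single (single i 1) 1 * single m' 1 \<in> Jac f"
        unfolding Jac_def by (rule ideal_gen_mult)
      then show ?thesis by (simp add: mult_single m)
    qed
  qed
  then show ?thesis by (auto simp: monomials_in_Jac_def)
qed

lemma mpderiv_keys: "m \<in> keys (mpderiv i f) \<Longrightarrow> m + single i 1 \<in> keys f"
  by (auto simp: in_keys_iff lookup_mpderiv)

lemma mpderiv_homogeneous: "whomogeneous \<omega> d f \<Longrightarrow> m \<in> keys (mpderiv j f) \<Longrightarrow> wdeg \<omega> m + \<omega> j = d"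
  using mpderiv_keys[of m j f] by (auto simp: whomogeneous_def wdeg_add wdeg_single)

lemma sum_fun_apply: "(\<Sum>i\<in>I. f i) x = (\<Sum>i\<in>I. f i x)"
  by (induction I rule: infinite_finite_induct) auto

lemma const_in: "const_funs \<subseteq> A \<Longrightarrow> (\<lambda>x. c) \<in> A"
  by (auto simp: const_funs_def)

text \<open>The coefficients of \<open>q * mpderiv j f\<close> are linear in the coefficients of \<open>f\<close>. The subring \<open>A\<close> only has the coordinate functions
in degree \<open>d\<close>, whose number is finite; hence the agreement is claimed on homogeneous \<open>f\<close> alone.\<close>
lemma lookup_mult_mpderiv_polynomial:
  fixes A :: "(('n::finite, 'a::field) mpoly \<Rightarrow> 'a) set"
  assumes A: "subring_set A" "const_funs \<subseteq> A" "\<And>m. wdeg \<omega> m = d \<Longrightarrow> (\<lambda>f. lookup f m) \<in> A"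
  shows "\<exists>p\<in>A. \<forall>f. whomogeneous \<omega> d f \<longrightarrow> p f = lookup (q * mpderiv j f) u"
proof -
  have "\<exists>p\<in>A. \<forall>f. whomogeneous \<omega> d f \<longrightarrow> p f = lookup (single a c * mpderiv j f) u" for a c
  proof (cases "\<exists>v. u = a + v \<and> wdeg \<omega> (v + single j 1) = d")
    case True
    then obtain v where v: "u = a + v" "wdeg \<omega> (v + single j 1) = d" by blast
    have "(\<lambda>f. c * of_nat (lookup v j + 1)) * (\<lambda>f. lookup f (v + single j 1)) \<in> A"
      by (intro subring_setD(4)[OF A(1)] const_in A v)
    then show ?thesis
      by (rule rev_bexI) (auto simp: v lookup_single_mult lookup_mpderiv simp del: of_nat_Suc of_nat_add)
  next
    case False
    have "lookup (single a c * mpderiv j f) u = 0" if f: "whomogeneous \<omega> d f" for f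
    proof (cases "\<exists>v. u = a + v")
      case True
      then obtain v where v: "u = a + v" by blast
      with False have "v + single j 1 \<notin> keys f" using f by (auto simp: whomogeneous_def)
      then show ?thesis by (simp add: v lookup_single_mult lookup_mpderiv in_keys_iff)
    next
      case False
      then show ?thesis by (intro lookup_single_mult_notin) auto
    qed
    then show ?thesis by (intro bexI[of _ 0]) (auto simp: subring_setD[OF A(1)])
  qed
  then obtain p where p: "\<And>a c. p a c \<in> A" 
    "\<And>a c f. whomogeneous \<omega> d f \<Longrightarrow> p a c f = lookup (single a c * mpderiv j f) u" by metis
  have "lookup (q * mpderiv j f) u = (\<Sum>a\<in>keys q. p a (lookup q a)) f" if "whomogeneous \<omega> d f" for f
    by (subst poly_mapping_expand[of q])
       (simp add: sum_distrib_right lookup_sum sum_fun_apply p(2)[OF that])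
  moreover have "(\<Sum>a\<in>keys q. p a (lookup q a)) \<in> A" by (intro subring_set_sum A p)
  ultimately show ?thesis by (metis (no_types, lifting))
qed

definition mon_part :: "('m \<Rightarrow> bool) \<Rightarrow> ('m \<Rightarrow>\<^sub>0 'a::comm_monoid_add) \<Rightarrow> 'm \<Rightarrow>\<^sub>0 'a" where
  "mon_part P q = (\<Sum>m\<in>{m\<in>keys q. P m}. single m (lookup q m))"

lemma keys_mon_part: "keys (mon_part P q) \<subseteq> {m. P m}"
proof
  fix m assume "m \<in> keys (mon_part P q)"
  then have "(\<Sum>k\<in>{m\<in>keys q. P m}. lookup (single k (lookup q k)) m) \<noteq> 0"
    by (simp add: mon_part_def in_keys_iff lookup_sum)
  then obtain k where "k \<in> {m\<in>keys q. P m}" "lookup (single k (lookup q k)) m \<noteq> 0"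
    by (rule sum.not_neutral_contains_not_neutral)
  then show "m \<in> {m. P m}" by (auto simp: lookup_single when_def split: if_splits)
qed

lemma mon_part_split: "q = mon_part P q + mon_part (\<lambda>m. \<not> P m) q"
proof -
  have "keys q = {m\<in>keys q. P m} \<union> {m\<in>keys q. \<not> P m}" by auto
  then have "(\<Sum>m\<in>keys q. single m (lookup q m)) = mon_part P q + mon_part (\<lambda>m. \<not> P m) q"
    unfolding mon_part_def by (subst sum.union_disjoint[symmetric]) auto
  then show ?thesis using poly_mapping_expand[of q] by simp
qed

text \<open>The multipliers of an arbitrary representation may be replaced by their parts in the degree
\<open>wdeg \<omega> s + \<omega> j - d\<close>, since each partial derivative is homogeneous. The degree condition is written without subtraction.\<close>
lemma homogeneous_Jac_representation:
  fixes f :: "('n::finite, 'a::comm_ring_1) mpoly"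
  assumes f: "whomogeneous \<omega> d f" and s: "single s 1 \<in> Jac f"
  shows "\<exists>q. single s 1 = (\<Sum>j\<in>UNIV. q j * mpderiv j f) \<and>
             (\<forall>j. \<forall>a\<in>keys (q j). wdeg \<omega> a + d = wdeg \<omega> s + \<omega> j)"
proof -
  obtain q where q: "single s 1 = (\<Sum>j\<in>UNIV. q j * mpderiv j f)"
    using ideal_gen_range_finite s unfolding Jac_def by blast
  define P where "P j a \<longleftrightarrow> wdeg \<omega> a + d = wdeg \<omega> s + \<omega> j" for j a
  have "lookup (single s 1) m = lookup (\<Sum>j\<in>UNIV. mon_part (P j) (q j) * mpderiv j f) m" for m
  proof (cases "wdeg \<omega> m = wdeg \<omega> s")
    case True
    have "lookup (mon_part (\<lambda>a. \<not> P j a) (q j) * mpderiv j f) m = 0" for j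
    proof (rule ccontr)
      assume "\<not> ?thesis"
      then obtain a b where ab: "m = a + b" "a \<in> keys (mon_part (\<lambda>a. \<not> P j a) (q j))" "b \<in> keys (mpderiv j f)"
        using keys_mult by (fastforce simp: in_keys_iff[symmetric])
      then show False
        using keys_mon_part[of "\<lambda>a. \<not> P j a" "q j"] mpderiv_homogeneous[OF f, of b j] True
        by (auto simp: P_def wdeg_add)
    qed
    moreover have "q j * mpderiv j f = mon_part (P j) (q j) * mpderiv j f + mon_part (\<lambda>a. \<not> P j a) (q j) * mpderiv j f" for j
      by (metis mon_part_split distrib_right)
    ultimately show ?thesis unfolding q by (simp add: lookup_sum lookup_add)
  next
    case False
    have "lookup (mon_part (P j) (q j) * mpderiv j f) m = 0" for j
    proof (rule ccontr)
      assume "\<not> ?thesis"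
      then obtain a b where ab: "m = a + b" "a \<in> keys (mon_part (P j) (q j))" "b \<in> keys (mpderiv j f)"
        using keys_mult by (fastforce simp: in_keys_iff[symmetric])
      then show False
        using keys_mon_part[of "P j" "q j"] mpderiv_homogeneous[OF f, of b j] False
        by (auto simp: P_def wdeg_add)
    qed
    then show ?thesis using False by (auto simp: lookup_sum lookup_single when_def)
  qed
  then have "single s 1 = (\<Sum>j\<in>UNIV. mon_part (P j) (q j) * mpderiv j f)" by (rule poly_mapping_eqI)
  then show ?thesis
    using keys_mon_part[of "P _" "q _"] 
    by (intro exI[of _ "\<lambda>j. mon_part (P j) (q j)"]) (auto simp: P_def)
qed

text \<open>Write each monomial \<open>s\<close> of the window as \<open>\<Sum>\<^sub>j q s j * mpderiv j f0\<close> and keep the multipliers \<open>q s j\<close> while \<open>f0\<close>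
varies: \<open>G s f = \<Sum>\<^sub>j q s j * mpderiv j f\<close> differs from the monomial \<open>s\<close> by a combination of window
monomials whose coefficients are polynomial in \<open>f\<close> and vanish at \<open>f0\<close>. As \<open>G s f\<close> is in \<open>Jac f\<close>, Nakayama's lemma applies.
Homogeneity keeps the error terms inside the window.\<close>
lemma monomials_in_Jac_open:
  fixes A :: "(('n::finite, 'a::field) mpoly \<Rightarrow> 'a) set" and \<omega> :: "'n \<Rightarrow> nat"
  assumes A: "subring_set A" "const_funs \<subseteq> A" "\<And>m. wdeg \<omega> m = d \<Longrightarrow> (\<lambda>f. lookup f m) \<in> A"
    and \<omega>: "\<And>i. 0 < \<omega> i"
    and f0: "whomogeneous \<omega> d f0" "monomials_in_Jac \<omega> t f0"
  shows "\<exists>h\<in>A. h f0 \<noteq> 0 \<and> (\<forall>f. whomogeneous \<omega> d f \<longrightarrow> h f \<noteq> 0 \<longrightarrow> monomials_in_Jac \<omega> t f)"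
proof -
  define N where "N = (\<Sum>i\<in>UNIV. \<omega> i)"
  have N: "\<omega> i \<le> N" for i unfolding N_def by (rule member_le_sum) auto
  define I where "I = {m. t \<le> wdeg \<omega> m \<and> wdeg \<omega> m < t + N}"
  have "finite I" by (rule finite_subset[OF _ finite_wdeg_le[where \<omega> = \<omega> and D = "t + N", OF \<omega>]]) (auto simp: I_def)
  define Q where "Q s q \<longleftrightarrow> single s 1 = (\<Sum>j\<in>UNIV. q j * mpderiv j f0) \<and>
             (\<forall>j. \<forall>a\<in>keys (q j). wdeg \<omega> a + d = wdeg \<omega> s + \<omega> j)" for s q
  have "\<forall>s\<in>I. \<exists>q. Q s q"
    using homogeneous_Jac_representation[OF f0(1)] f0(2) by (auto simp: Q_def I_def monomials_in_Jac_def)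
  from bchoice[OF this] obtain q where Q: "\<And>s. s \<in> I \<Longrightarrow> Q s (q s)" by blast
  have q: "single s 1 = (\<Sum>j\<in>UNIV. q s j * mpderiv j f0)" if "s \<in> I" for s
    using Q[OF that] by (simp add: Q_def)
  have qk: "wdeg \<omega> a + d = wdeg \<omega> s + \<omega> j" if "s \<in> I" "a \<in> keys (q s j)" for s j a
    using Q[OF that(1)] that(2) by (simp add: Q_def)
  define G where "G s f = (\<Sum>j\<in>UNIV. q s j * mpderiv j f)" for s f
  have G_Jac: "G s f \<in> Jac f" for s f
    unfolding G_def Jac_def by (intro ideal_gen_sum ideal_gen_mult ideal_gen_base) auto
  have G_keys: "keys (G s f) \<subseteq> I" if f: "whomogeneous \<omega> d f" and s: "s \<in> I" for s f
  proof
    fix m assume "m \<in> keys (G s f)"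
    then have "(\<Sum>j\<in>UNIV. lookup (q s j * mpderiv j f) m) \<noteq> 0"
      by (simp add: G_def in_keys_iff lookup_sum)
    then obtain j where "lookup (q s j * mpderiv j f) m \<noteq> 0"
      by (rule sum.not_neutral_contains_not_neutral)
    then obtain a b where ab: "m = a + b" "a \<in> keys (q s j)" "b \<in> keys (mpderiv j f)"
      using keys_mult by (fastforce simp: in_keys_iff[symmetric])
    then have "wdeg \<omega> m = wdeg \<omega> s"
      using qk[OF s ab(2)] mpderiv_homogeneous[OF f ab(3)] by (simp add: wdeg_add)
    then show "m \<in> I" using s by (simp add: I_def)
  qed
  define L0 where "L0 s u j = (SOME p. p \<in> A \<and>
      (\<forall>f. whomogeneous \<omega> d f \<longrightarrow> p f = lookup (q s j * mpderiv j f) u))" for s u j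
  have "L0 s u j \<in> A \<and>
      (\<forall>f. whomogeneous \<omega> d f \<longrightarrow> L0 s u j f = lookup (q s j * mpderiv j f) u)" for s u j
    unfolding L0_def using lookup_mult_mpderiv_polynomial[OF A, unfolded Bex_def] by (rule someI_ex)
  then have L0: "\<And>s u j. L0 s u j \<in> A" 
      "\<And>s u j f. whomogeneous \<omega> d f \<Longrightarrow> L0 s u j f = lookup (q s j * mpderiv j f) u"
    by blast+
  define p where "p s u = (\<lambda>f. if s = u then 1 else 0) - (\<Sum>j\<in>UNIV. L0 s u j)" for s u
  have pA: "p s u \<in> A" for s u
    unfolding p_def by (intro subring_setD(3)[OF A(1)] const_in A subring_set_sum L0)
  have p: "p s u f = (if s = u then 1 else 0) - lookup (G s f) u" if "whomogeneous \<omega> d f" for s u f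
    using L0(2)[OF that] by (simp add: p_def G_def lookup_sum sum_fun_apply)
  have p0: "p s u \<in> A \<and> p s u f0 = 0" if "s \<in> I" "u \<in> I" for s u
  proof -
    have "G s f0 = single s 1" using q[OF that(1)] by (simp add: G_def)
    then show ?thesis using pA p[OF f0(1), of s u] by (auto simp: lookup_single when_def)
  qed
  have one: "1 \<in> A \<and> (1 :: ('n, 'a) mpoly \<Rightarrow> 'a) f0 \<noteq> 0" by (simp add: subring_setD[OF A(1)])
  have "\<exists>h\<in>A. h f0 \<noteq> 0 \<and> (\<forall>f V e. h f \<noteq> 0 \<longrightarrow> mpoly_vs.subspace V \<longrightarrow>
      (\<forall>s\<in>I. single 0 ((1 :: ('n, 'a) mpoly \<Rightarrow> 'a) f) * (e s :: ('n, 'a) mpoly) - (\<Sum>u\<in>I. single 0 (p s u f) * e u) \<in> V)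
       \<longrightarrow> (\<forall>s\<in>I. e s \<in> V))"
    by (rule mpoly_vs.Nakayama_elimination[OF A(1) \<open>finite I\<close> one p0])
  then obtain h where h: "h \<in> A" "h f0 \<noteq> 0" and hV: "\<forall>f V e. h f \<noteq> 0 \<longrightarrow> mpoly_vs.subspace V \<longrightarrow>
      (\<forall>s\<in>I. single 0 ((1 :: ('n, 'a) mpoly \<Rightarrow> 'a) f) * (e s :: ('n, 'a) mpoly) - (\<Sum>u\<in>I. single 0 (p s u f) * e u) \<in> V)
       \<longrightarrow> (\<forall>s\<in>I. e s \<in> V)"
    by (elim bexE conjE)
  show ?thesis
  proof (intro bexI[OF _ h(1)] conjI allI impI)
    fix f assume f: "whomogeneous \<omega> d f" and "h f \<noteq> 0"
    have "\<forall>s\<in>I. single s (1 :: 'a) \<in> Jac f"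
    proof (rule hV[rule_format, OF \<open>h f \<noteq> 0\<close>, THEN ballI], unfold mpoly_vs.subspace_def one_fun_apply, safe)
      fix s assume s: "s \<in> I"
      have "(\<Sum>u\<in>I. single u (if s = u then 1 else 0 :: 'a)) = single s 1"
        by (subst sum.cong[OF refl, of _ _ "\<lambda>u. if u = s then single u 1 else 0"]) (use s \<open>finite I\<close> in auto)
      moreover have "(\<Sum>u\<in>I. single u (lookup (G s f) u)) = G s f"
        by (subst (2) poly_mapping_expand)
           (rule sum.mono_neutral_right, use \<open>finite I\<close> G_keys[OF f s] in \<open>auto simp: in_keys_iff\<close>)
      ultimately have "single 0 (1 :: 'a) * single s 1 - (\<Sum>u\<in>I. single 0 (p s u f) * single u 1) = G s f"
        by (simp add: mult_single) (simp add: p[OF f] single_diff sum_subtractf)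
      then show "single 0 (1 :: 'a) * single s 1 - (\<Sum>u\<in>I. single 0 (p s u f) * single u 1) \<in> Jac f"
        using G_Jac[of s f] by simp
    qed (auto simp: Jac_def ideal_gen_zero ideal_gen_add ideal_gen_mult)
    then show "monomials_in_Jac \<omega> t f"
      by (intro monomials_in_Jac_window[of \<omega> N]) (auto simp: I_def \<omega> N)
  qed (rule h(2))
qed

lemma monomials_in_Jac_mono: "monomials_in_Jac \<omega> t f \<Longrightarrow> t \<le> t' \<Longrightarrow> monomials_in_Jac \<omega> t' f"
  by (auto simp: monomials_in_Jac_def)

text \<open>Otherwise there are \<open>f\<^sub>0, f\<^sub>1, \<dots>\<close> and \<open>t\<^sub>0 \<le> t\<^sub>1 \<le> \<dots>\<close> such that \<open>t\<^sub>n\<close> works for \<open>f\<^sub>n\<close> but for none of the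
later ones. The functions \<open>h\<^sub>n\<close> that describe neighbourhoods of \<open>f\<^sub>n\<close> then vanish at all later points, contrary to
the chain condition for zero sets.\<close>
theorem uniform_monomials_in_Jac:
  fixes \<omega> :: "'n::finite \<Rightarrow> nat"
  assumes \<omega>: "\<And>i. 0 < \<omega> i"
  shows "\<exists>t. \<forall>f :: ('n, 'a::field) mpoly. whomogeneous \<omega> d f \<longrightarrow> (\<exists>t'. monomials_in_Jac \<omega> t' f) \<longrightarrow>
    monomials_in_Jac \<omega> t f"
proof (rule ccontr)
  assume neg: "\<not> ?thesis"
  let ?T = "monomials_in_Jac \<omega> :: nat \<Rightarrow> ('n, 'a) mpoly \<Rightarrow> bool"
  have step: "\<exists>f t'. whomogeneous \<omega> d f \<and> ?T t' f \<and> \<not> ?T t f \<and> t \<le> t'" for t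
  proof -
    obtain f t' where "whomogeneous \<omega> d f" "?T t' f" "\<not> ?T t f" using neg by blast
    then show ?thesis using monomials_in_Jac_mono[of \<omega> t' f "max t t'"] by (metis max.cobounded1 max.cobounded2)
  qed
  have "\<exists>x. \<forall>n. (whomogeneous \<omega> d (fst (x n)) \<and> ?T (snd (x n)) (fst (x n))) \<and>
           (\<not> ?T (snd (x n)) (fst (x (Suc n))) \<and> snd (x n) \<le> snd (x (Suc n)))"
    using step by (intro dependent_nat_choice) fastforce+
  then obtain x where x: "\<And>n. whomogeneous \<omega> d (fst (x n))" "\<And>n. ?T (snd (x n)) (fst (x n))"
     "\<And>n. \<not> ?T (snd (x n)) (fst (x (Suc n)))" "\<And>n. snd (x n) \<le> snd (x (Suc n))" by blast
  have fin: "finite ((\<lambda>m f. lookup f m) ` {m. wdeg \<omega> m = d} :: (('n, 'a) mpoly \<Rightarrow> 'a) set)"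
    by (intro finite_imageI finite_subset[OF _ finite_wdeg_le[where \<omega> = \<omega> and D = d, OF \<omega>]]) auto
  obtain A :: "(('n, 'a) mpoly \<Rightarrow> 'a) set" where A: "subring_set A" "noeth A" "const_funs \<subseteq> A" 
      "\<And>m. wdeg \<omega> m = d \<Longrightarrow> (\<lambda>f. lookup f m) \<in> A"
    using finite_adjoin_noeth[OF subring_const_funs noeth_const_funs fin] by blast
  have "\<forall>n. \<exists>h\<in>A. h (fst (x n)) \<noteq> 0 \<and> (\<forall>f. whomogeneous \<omega> d f \<longrightarrow> h f \<noteq> 0 \<longrightarrow> ?T (snd (x n)) f)"
    using monomials_in_Jac_open[OF A(1,3,4) \<omega> x(1) x(2)] by blast
  then obtain h where h: "\<And>n. h n \<in> A" "\<And>n. h n (fst (x n)) \<noteq> 0"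
     "\<And>n f. whomogeneous \<omega> d f \<Longrightarrow> h n f \<noteq> 0 \<Longrightarrow> ?T (snd (x n)) f" by metis
  have "\<exists>i j. i < j \<and> h i (fst (x j)) \<noteq> 0"
    by (rule noeth_zero_sets[OF A(2) h(1) h(2)])
  then obtain i j where ij: "i < j" "h i (fst (x j)) \<noteq> 0" by blast
  then obtain k where k: "j = Suc k" "i \<le> k" by (cases j) auto
  have "?T (snd (x i)) (fst (x j))" using h(3) x(1) ij(2) by blast
  moreover have "snd (x i) \<le> snd (x k)" using x(4) k(2) by (rule lift_Suc_mono_le[where f = "\<lambda>n. snd (x n)"])
  ultimately show False using monomials_in_Jac_mono x(3) k(1) by blast
qed

lemma W_monomials_in_Jac:
  fixes \<omega> :: "'n::finite \<Rightarrow> nat"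
  assumes f: "f \<in> W \<omega>" and \<omega>: "\<And>i. 0 < \<omega> i"
  shows "\<exists>t. monomials_in_Jac \<omega> t f"
proof -
  have "Var i \<in> ideal_radical (Jac f)" for i
    using f unfolding W_def max_ideal_def by (auto intro: ideal_gen_base)
  then obtain k where k: "\<And>i. Var i ^ k i \<in> Jac f" unfolding ideal_radical_def by auto metis
  have "single m 1 \<in> Jac f" if m: "(\<Sum>i\<in>UNIV. \<omega> i * k i) \<le> wdeg \<omega> m" for m
  proof -
    have "\<exists>i. k i \<le> lookup m i"
    proof (rule ccontr)
      assume "\<not> ?thesis"
      then have "wdeg \<omega> m < (\<Sum>i\<in>UNIV. \<omega> i * k i)"
        unfolding wdeg_def using \<omega> by (intro sum_strict_mono) (auto simp: not_le)
      then show False using m by simp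
    qed
    then obtain i where i: "k i \<le> lookup m i" by blast
    have "single (m - single i (k i)) 1 * Var i ^ k i \<in> Jac f"
      using k[of i] unfolding Jac_def by (rule ideal_gen_mult)
    then show ?thesis using monomial_split[OF i] by (simp add: Var_power mult_single add.commute)
  qed
  then show ?thesis unfolding monomials_in_Jac_def by blast
qed

section \<open>Frobenius powers of ideals and derivations\<close>

lemma frob_power_iff:
  fixes g :: "('n, 'a::comm_ring_1) mpoly"
  shows "g \<in> frob_power q \<longleftrightarrow> (\<forall>m\<in>keys g. \<exists>i. q \<le> lookup m i)"
proof
  assume g: "g \<in> frob_power q"
  have "g \<in> {g. \<forall>m\<in>keys g. \<exists>i. q \<le> lookup m i}"
  proof (rule ideal_gen_minimal[OF g[unfolded frob_power_def]])
    show "range (\<lambda>i. Var i ^ q) \<subseteq> {g :: ('n, 'a) mpoly. \<forall>m\<in>keys g. \<exists>i. q \<le> lookup m i}"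
      by (auto simp: Var_power) (metis lookup_single_eq order_refl)
    show "a + b \<in> {g. \<forall>m\<in>keys g. \<exists>i. q \<le> lookup m i}"
      if "a \<in> {g. \<forall>m\<in>keys g. \<exists>i. q \<le> lookup m i}" "b \<in> {g. \<forall>m\<in>keys g. \<exists>i. q \<le> lookup m i}" 
      for a b :: "('n, 'a) mpoly"
      using that keys_add[of a b] by blast
    show "r * a \<in> {g. \<forall>m\<in>keys g. \<exists>i. q \<le> lookup m i}"
      if "a \<in> {g. \<forall>m\<in>keys g. \<exists>i. q \<le> lookup m i}" for r a :: "('n, 'a) mpoly"
    proof (safe)
      fix m assume "m \<in> keys (r * a)"
      then obtain x y where "m = x + y" "y \<in> keys a" using keys_mult by blast
      then show "\<exists>i. q \<le> lookup m i" using that by (auto simp: lookup_add intro: trans_le_add2)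
    qed
  qed auto
  then show "\<forall>m\<in>keys g. \<exists>i. q \<le> lookup m i" by simp
next
  assume *: "\<forall>m\<in>keys g. \<exists>i. q \<le> lookup m i"
  have "(\<Sum>m\<in>keys g. single m (lookup g m)) \<in> frob_power q"
    unfolding frob_power_def
  proof (rule ideal_gen_sum)
    fix m assume "m \<in> keys g"
    then obtain i where i: "q \<le> lookup m i" using * by blast
    have "single (m - single i q) (lookup g m) * Var i ^ q \<in> ideal_gen (range (\<lambda>i. Var i ^ q))"
      by (intro ideal_gen_mult ideal_gen_base) auto
    then show "single m (lookup g m) \<in> ideal_gen (range (\<lambda>i. Var i ^ q))"
      using monomial_split[OF i] by (simp add: Var_power mult_single add.commute)
  qed
  then show "g \<in> frob_power q" using poly_mapping_expand[of g] by simp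
qed

lemma frob_power_mult: "a \<in> frob_power q \<Longrightarrow> r * a \<in> frob_power q"
  unfolding frob_power_def by (rule ideal_gen_mult)

lemma CHAR_mpoly: "CHAR(('n, 'a::comm_ring_1) mpoly) = CHAR('a)"
proof (rule CHAR_eqI)
  show "of_nat CHAR('a) = (0 :: ('n, 'a) mpoly)" by (simp flip: single_of_nat)
  show "CHAR('a) dvd k" if "of_nat k = (0 :: ('n, 'a) mpoly)" for k
  proof -
    have "lookup (of_nat k :: ('n, 'a) mpoly) 0 = 0" using that by simp
    then show ?thesis by (simp add: of_nat_eq_0_iff_char_dvd flip: single_of_nat)
  qed
qed

text \<open>The exponent vector of the \<open>k\<close>-th power of a monomial.\<close>
definition smul :: "nat \<Rightarrow> ('n \<Rightarrow>\<^sub>0 nat) \<Rightarrow> ('n \<Rightarrow>\<^sub>0 nat)" where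
  "smul k m = Poly_Mapping.map ((*) k) m"

lemma lookup_smul [simp]: "lookup (smul k m) i = k * lookup m i"
  by (simp add: smul_def Poly_Mapping.map.rep_eq when_def)

lemma single_power: "single m c ^ k = (single (smul k m) (c ^ k) :: ('n, 'a::comm_ring_1) mpoly)"
proof (induction k)
  case 0
  have "smul 0 m = 0" by (rule poly_mapping_eqI) simp
  then show ?case by simp
next
  case (Suc k)
  have "smul (Suc k) m = m + smul k m" by (rule poly_mapping_eqI) (simp add: lookup_add)
  then show ?case by (simp add: Suc mult_single)
qed

lemma smul_inj: "0 < k \<Longrightarrow> smul k a = smul k b \<Longrightarrow> a = b"
  by (rule poly_mapping_eqI) (metis lookup_smul nat_mult_eq_cancel1)

context
  fixes q e :: nat
  assumes char: "prime CHAR('a::field)" and q: "q = CHAR('a) ^ e"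
begin

lemma Frobenius_add: "(f + g) ^ q = f ^ q + (g ^ q :: ('n, 'a) mpoly)"
  by (rule freshmans_dream') (use char q in \<open>auto simp: CHAR_mpoly\<close>)

lemma Frobenius_keys:
  fixes f :: "('n, 'a) mpoly"
  shows "keys (f ^ q) = smul q ` keys f"
proof -
  have q0: "0 < q" using char q prime_gt_0_nat by simp
  have "f ^ q = (\<Sum>m\<in>keys f. single m (lookup f m)) ^ q"
    using poly_mapping_expand[of f] by simp
  also have "\<dots> = (\<Sum>m\<in>keys f. single (smul q m) (lookup f m ^ q))"
    by (subst freshmans_dream_sum'[OF _ ]) (use char q in \<open>auto simp: CHAR_mpoly single_power\<close>)
  finally have eq: "lookup (f ^ q) k = (\<Sum>m\<in>keys f. lookup f m ^ q when smul q m = k)" for k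
    by (simp add: lookup_sum lookup_single)
  have "lookup (f ^ q) (smul q m) = lookup f m ^ q" for m
  proof -
    have "lookup (f ^ q) (smul q m) = (\<Sum>k\<in>keys f. if k = m then lookup f m ^ q else 0)"
      unfolding eq by (rule sum.cong) (auto simp: when_def dest: smul_inj[OF q0])
    then show ?thesis using q0 by (auto simp: in_keys_iff)
  qed
  moreover have "k \<in> smul q ` keys f" if "k \<in> keys (f ^ q)" for k
  proof (rule ccontr)
    assume "\<not> ?thesis"
    then have "lookup (f ^ q) k = 0" unfolding eq by (intro sum.neutral) (auto simp: when_def)
    then show False using that by (simp add: in_keys_iff)
  qed
  ultimately show ?thesis using q0 by (auto simp: in_keys_iff)
qed

text \<open>By \<open>Frobenius_keys\<close> no exponent vector of \<open>f\<close> is lost or gained on passing to \<open>f ^ q\<close>: this is the flatness of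
Frobenius on the polynomial ring, for monomial ideals.\<close>
lemma Frobenius_frob_power:
  fixes f :: "('n, 'a) mpoly"
  shows "f ^ q \<in> frob_power (q * r) \<longleftrightarrow> f \<in> frob_power r"
proof -
  have "0 < q" using char q prime_gt_0_nat by simp
  then show ?thesis by (simp add: frob_power_iff Frobenius_keys)
qed

text \<open>Modulo \<open>frob_power r\<close>, the polynomial \<open>g\<close> is a nonzero multiple of the socle generator, the monomial with all
exponents \<open>r - 1\<close>. Its \<open>q\<close>-th power shifts the exponents by \<open>q * r - q\<close>, which carries the
exponents below \<open>q\<close> of a surviving monomial of \<open>h\<close> to exponents below \<open>q * r\<close>.\<close>
lemma socle_times_Frobenius:
  fixes g h :: "('n, 'a) mpoly"
  assumes r: "0 < r" and c: "c \<in> keys g"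
    and max: "\<And>i. lookup c i = r - 1"
    and uniq: "\<And>m. m \<in> keys g \<Longrightarrow> (\<And>i. lookup m i < r) \<Longrightarrow> m = c"
    and h: "h \<notin> frob_power q"
  shows "g ^ q * h \<notin> frob_power (q * r)"
proof
  assume *: "g ^ q * h \<in> frob_power (q * r)"
  define s where "s = single c (lookup g c)"
  have "lookup (g - s) m = (if m = c then 0 else lookup g m)" for m
    by (auto simp: s_def lookup_minus lookup_single when_def)
  then have "g - s \<in> frob_power r"
    using uniq by (auto simp: frob_power_iff in_keys_iff split: if_splits) (metis not_less)
  then have "(g - s) ^ q \<in> frob_power (q * r)" by (simp add: Frobenius_frob_power)
  then have "h * (g - s) ^ q \<in> frob_power (q * r)" by (rule frob_power_mult)
  moreover have "g ^ q = s ^ q + (g - s) ^ q" using Frobenius_add[of s "g - s"] by simp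
  then have eq: "g ^ q * h = s ^ q * h + h * (g - s) ^ q" by (simp add: algebra_simps)
  ultimately have "g ^ q * h + (- 1) * (h * (g - s) ^ q) \<in> frob_power (q * r)"
    using * frob_power_mult[of "h * (g - s) ^ q" "q * r" "- 1"] unfolding frob_power_def
    by (intro ideal_gen_add)
  then have "s ^ q * h \<in> frob_power (q * r)" unfolding eq by simp
  moreover obtain b where b: "b \<in> keys h" "\<And>i. lookup b i < q" 
    using h by (auto simp: frob_power_iff not_le)
  have "lookup (s ^ q * h) (smul q c + b) \<noteq> 0"
    using b(1) c by (simp add: s_def single_power lookup_single_mult in_keys_iff)
  then have "smul q c + b \<in> keys (s ^ q * h)" by (simp add: in_keys_iff)
  ultimately obtain i where "q * r \<le> lookup (smul q c + b) i"
    unfolding frob_power_iff by blast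
  then have "q * r \<le> q * lookup c i + lookup b i" by (simp add: lookup_add)
  moreover have "q * lookup c i + lookup b i < q * lookup c i + q" using b(2) by simp
  moreover have "q * lookup c i + q = q * r" using r by (simp add: max algebra_simps)
  ultimately show False by simp
qed

end

lemma mpderiv_add: "mpderiv j (f + g) = mpderiv j f + mpderiv j g"
  by (rule poly_mapping_eqI) (simp add: lookup_mpderiv lookup_add algebra_simps)

lemma mpderiv_sum: "mpderiv j (sum f I) = (\<Sum>i\<in>I. mpderiv j (f i))"
proof (induction I rule: infinite_finite_induct)
  case (insert i I) then show ?case by (simp add: mpderiv_add)
qed (auto simp: mpderiv_def)

lemma mpderiv_single: "mpderiv j (single m c) = single (m - single j 1) (of_nat (lookup m j) * c)"
  by (cases "c = 0") (simp_all add: mpderiv_def)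

lemma mpderiv_mult_single:
  fixes c c' :: "'a::comm_ring_1"
  shows "mpderiv j (single a c * single b c') = 
     mpderiv j (single a c) * single b c' + single a c * mpderiv j (single b c')"
proof -
  have 1: "single (a - single j 1 + b) (of_nat (lookup a j) * x) = single (a + b - single j 1) (of_nat (lookup a j) * x)"
    for a b and x :: 'a
  proof (cases "lookup a j = 0")
    case False
    then have "a - single j 1 + b = a + b - single j 1"
      by (intro poly_mapping_eqI) (auto simp: lookup_add lookup_minus lookup_single when_def)
    then show ?thesis by simp
  qed simp
  have 2: "single (a + (b - single j 1)) (c * (of_nat (lookup b j) * c')) =
     single (a + b - single j 1) (of_nat (lookup b j) * (c * c'))"
    using 1[of b a "c * c'"] by (simp add: ac_simps)
  show ?thesis
    using 1[of a b "c * c'"]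
    by (simp only: mult_single mpderiv_single 2) 
       (simp add: lookup_add algebra_simps flip: single_add)
qed

lemma mpderiv_mult: "mpderiv j (f * g) = mpderiv j f * g + f * mpderiv j g"
proof -
  have "mpderiv j ((\<Sum>a\<in>keys f. single a (lookup f a)) * (\<Sum>b\<in>keys g. single b (lookup g b))) =
     mpderiv j (\<Sum>a\<in>keys f. single a (lookup f a)) * (\<Sum>b\<in>keys g. single b (lookup g b)) + 
     (\<Sum>a\<in>keys f. single a (lookup f a)) * mpderiv j (\<Sum>b\<in>keys g. single b (lookup g b))"
    by (simp only: mpderiv_sum sum_product mpderiv_mult_single sum.distrib)
  then show ?thesis using poly_mapping_expand[of f] poly_mapping_expand[of g] by simp
qed

lemma mpderiv_power: "mpderiv j (f ^ Suc k) = of_nat (Suc k) * (f ^ k * mpderiv j f)"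
proof (induction k)
  case (Suc k)
  have "mpderiv j (f ^ Suc (Suc k)) = mpderiv j f * f ^ Suc k + f * mpderiv j (f ^ Suc k)"
    using mpderiv_mult[of j f "f ^ Suc k"] by simp
  then show ?case unfolding Suc by (simp add: algebra_simps)
qed simp

text \<open>The exponent of \<open>x\<^sub>j\<close> can drop below \<open>q\<close> only for the exponent \<open>q\<close> itself, and then differentiation produces the coefficient \<open>q = 0\<close>.\<close>
lemma mpderiv_frob_power:
  fixes g :: "('n, 'a::comm_ring_1) mpoly"
  assumes g: "g \<in> frob_power q" and q: "CHAR('a) dvd q"
  shows "mpderiv j g \<in> frob_power q"
  unfolding frob_power_iff
proof
  fix m assume m: "m \<in> keys (mpderiv j g)"
  then have "m + single j 1 \<in> keys g" by (rule mpderiv_keys)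
  then obtain i where i: "q \<le> lookup (m + single j 1) i" using g by (auto simp: frob_power_iff)
  have "of_nat (lookup m j + 1) \<noteq> (0 :: 'a)" using m by (auto simp: in_keys_iff lookup_mpderiv)
  then have "lookup m j + 1 \<noteq> q" using q of_nat_eq_0_iff_char_dvd[where 'a = 'a] by metis
  then have "q \<le> lookup m i"
    using i by (auto simp: lookup_add lookup_single when_def split: if_splits)
  then show "\<exists>i. q \<le> lookup m i" by blast
qed

lemma whomogeneous_mult:
  "whomogeneous \<omega> a f \<Longrightarrow> whomogeneous \<omega> b g \<Longrightarrow> whomogeneous \<omega> (a + b) (f * g)"
  using keys_mult[of f g] by (fastforce simp: whomogeneous_def wdeg_add)

lemma whomogeneous_power: "whomogeneous \<omega> d f \<Longrightarrow> whomogeneous \<omega> (d * k) (f ^ k)"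
proof (induction k)
  case 0 then show ?case by (simp add: whomogeneous_def wdeg_def)
next
  case (Suc k) then show ?case using whomogeneous_mult[of \<omega> d f "d * k" "f ^ k"] by simp
qed

lemma ex_power_congruent_1:
  fixes p d :: nat
  assumes "coprime p d" "0 < d" "0 < p"
  shows "\<exists>e k. 0 < e \<and> p ^ e = 1 + d * k"
proof -
  have "\<not> inj_on (\<lambda>i. p ^ i mod d) {..d}"
  proof
    assume "inj_on (\<lambda>i. p ^ i mod d) {..d}"
    then have "card {..d} = card ((\<lambda>i. p ^ i mod d) ` {..d})" by (simp add: card_image)
    also have "\<dots> \<le> card {..<d}" using assms by (intro card_mono) auto
    finally show False by simp
  qed
  then obtain i j where "p ^ i mod d = p ^ j mod d" "i \<noteq> j" by (auto simp: inj_on_def)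
  then obtain i j where ij: "p ^ i mod d = p ^ j mod d" "i < j" by (metis linorder_neqE_nat)
  then have "d dvd p ^ j - p ^ i" 
    using mod_eq_dvd_iff_nat[of "p ^ i" "p ^ j" d] assms(3) by (simp add: power_increasing)
  also have "p ^ j - p ^ i = p ^ i * (p ^ (j - i) - 1)"
    using ij(2) by (simp add: diff_mult_distrib2 flip: power_add)
  finally have "d dvd p ^ (j - i) - 1"
    using assms(1) by (metis coprime_commute coprime_dvd_mult_right_iff coprime_power_right_iff)
  then obtain k where "p ^ (j - i) - 1 = d * k" by blast
  moreover have "0 < p ^ (j - i)" using assms by simp
  ultimately have "p ^ (j - i) = 1 + d * k" by linarith
  then show ?thesis using ij(2) by (intro exI[of _ "j - i"] exI[of _ k]) auto
qed

section \<open>The F-pure threshold of a quasi-homogeneous polynomial\<close>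

locale quasi_homogeneous =
  fixes f :: "('n::finite, 'a::field) mpoly" and \<omega> :: "'n \<Rightarrow> nat" and d :: nat
  assumes char_pos: "0 < CHAR('a)" and \<omega>_pos: "\<And>i. 0 < \<omega> i"
    and homogeneous: "whomogeneous \<omega> d f" and d_pos: "0 < d"
begin

definition "\<sigma> = (\<Sum>i\<in>UNIV. \<omega> i)"

lemma prime_CHAR: "prime CHAR('a)" using char_pos by (rule prime_CHAR_semidom)

lemma sigma_pos: "0 < \<sigma>" unfolding \<sigma>_def using \<omega>_pos by (intro sum_pos) auto

lemma wdeg_plus_sigma: "wdeg \<omega> m + \<sigma> = (\<Sum>i\<in>UNIV. \<omega> i * Suc (lookup m i))"
  by (simp add: wdeg_def \<sigma>_def sum.distrib add.commute)

lemma wdeg_lt: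
  assumes "\<And>i. lookup m i < q" shows "wdeg \<omega> m + \<sigma> \<le> q * \<sigma>"
proof -
  note wdeg_plus_sigma
  also have "(\<Sum>i\<in>UNIV. \<omega> i * Suc (lookup m i)) \<le> (\<Sum>i\<in>UNIV. \<omega> i * q)" using assms by (intro sum_mono mult_left_mono) (auto simp: Suc_le_eq)
  finally show ?thesis by (simp add: \<sigma>_def sum_distrib_left mult.commute)
qed

lemma power_keys_wdeg: "m \<in> keys (f ^ M) \<Longrightarrow> wdeg \<omega> m = d * M"
  using whomogeneous_power[OF homogeneous, of M] by (auto simp: whomogeneous_def)

lemma degree_bound: "f ^ M \<notin> frob_power q \<Longrightarrow> d * M + \<sigma> \<le> q * \<sigma>"
proof -
  assume "f ^ M \<notin> frob_power q"
  then obtain m where m: "m \<in> keys (f ^ M)" "\<And>i. lookup m i < q" by (auto simp: frob_power_iff not_le)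
  show ?thesis using wdeg_lt[OF m(2)] power_keys_wdeg[OF m(1)] by simp
qed

text \<open>The set in the definition of \<open>nu\<close> is finite by the degree bound and downward closed because \<open>frob_power\<close> is an ideal.
All later facts about \<open>nu\<close> use this equivalence in place of the maximum.\<close>
lemma nu_iff: "f ^ M \<notin> frob_power (CHAR('a) ^ e) \<longleftrightarrow> M \<le> nu f e"
proof -
  let ?S = "{M. f ^ M \<notin> frob_power (CHAR('a) ^ e)}"
  have "M \<le> CHAR('a) ^ e * \<sigma>" if "M \<in> ?S" for M
  proof -
    have "1 * M \<le> d * M" using d_pos by (intro mult_right_mono) auto
    moreover have "d * M + \<sigma> \<le> CHAR('a) ^ e * \<sigma>" using degree_bound that by simp
    ultimately show ?thesis by linarith
  qed
  then have fin: "finite ?S" by (intro finite_subset[of ?S "{..CHAR('a) ^ e * \<sigma>}"]) auto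
  have "0 \<in> ?S" using char_pos by (auto simp: frob_power_iff)
  then have in_S: "nu f e \<in> ?S" unfolding nu_def using fin \<open>0 \<in> ?S\<close> by (intro Max_in) blast+
  have "M \<in> ?S" if "M \<le> nu f e" for M
  proof
    have "f ^ nu f e = f ^ (nu f e - M) * f ^ M" using that by (simp flip: power_add)
    then show "f ^ M \<notin> frob_power (CHAR('a) ^ e)" using in_S frob_power_mult[of "f ^ M"] by auto
  qed
  moreover have "M \<le> nu f e" if "M \<in> ?S" for M
    unfolding nu_def using fin that by (rule Max_ge)
  ultimately show ?thesis by blast
qed

lemma nu_degree: "d * nu f e + \<sigma> \<le> CHAR('a) ^ e * \<sigma>"
  using degree_bound nu_iff by blast

lemma power_CHAR_frob_power: "(f ^ M) ^ (CHAR('a) ^ k) \<in> frob_power (CHAR('a) ^ k * r) \<longleftrightarrow> f ^ M \<in> frob_power r"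
  by (rule Frobenius_frob_power[OF prime_CHAR refl])

lemma nu_less: "nu f e < CHAR('a) ^ e"
proof -
  have "f \<in> frob_power 1"
    unfolding frob_power_iff
  proof (rule ballI, rule ccontr)
    fix m assume m: "m \<in> keys f" "\<not> (\<exists>i. 1 \<le> lookup m i)"
    then have "lookup m i = 0" for i by (simp add: Suc_le_eq)
    then have "wdeg \<omega> m = 0" by (simp add: wdeg_def)
    then show False using m(1) homogeneous d_pos by (auto simp: whomogeneous_def)
  qed
  then have "f ^ CHAR('a) ^ e \<in> frob_power (CHAR('a) ^ e)" using power_CHAR_frob_power[of 1 e 1] by simp
  then show ?thesis using nu_iff[of "CHAR('a) ^ e" e] by auto
qed

lemma nu_mult_le: "CHAR('a) ^ k * M \<le> nu f (k + e) \<longleftrightarrow> M \<le> nu f e"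
  using power_CHAR_frob_power[of M k "CHAR('a) ^ e"] unfolding nu_iff[symmetric]
  by (simp add: power_add mult.commute flip: power_mult)

lemma nu_shift_lower: "CHAR('a) ^ k * nu f e \<le> nu f (k + e)"
  by (simp add: nu_mult_le)

lemma nu_shift_upper: "nu f (k + e) + 1 \<le> CHAR('a) ^ k * (nu f e + 1)"
  using nu_mult_le[of k "nu f e + 1" e] by simp

text \<open>By the two shift inequalities \<open>nu f e / p\<^sup>e\<close> increases and \<open>(nu f e + 1) / p\<^sup>e\<close> decreases with \<open>e\<close>, where \<open>p\<close> is the characteristic.\<close>
lemma tendsto_fpt: "(\<lambda>e. real (nu f e) / real (CHAR('a) ^ e)) \<longlonglongrightarrow> fpt f"
  and nu_le_fpt: "real (nu f e) / real (CHAR('a) ^ e) \<le> fpt f"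
  and fpt_le_nu: "fpt f \<le> (real (nu f e) + 1) / real (CHAR('a) ^ e)"
proof -
  let ?a = "\<lambda>e. real (nu f e) / real (CHAR('a) ^ e)"
  have "incseq ?a"
  proof (rule incseq_SucI)
    fix e
    have "real (CHAR('a) * nu f e) \<le> real (nu f (Suc e))"
      using nu_shift_lower[of 1 e] by (subst of_nat_le_iff) simp
    then show "?a e \<le> ?a (Suc e)" using char_pos by (simp add: field_simps)
  qed
  moreover have "?a e \<le> 1" for e using nu_less[of e] by (simp add: divide_le_eq flip: of_nat_power)
  ultimately obtain L where L: "?a \<longlonglongrightarrow> L" "\<And>e. ?a e \<le> L"
    using incseq_convergent[of ?a 1] by blast
  then have "fpt f = L" unfolding fpt_def by (intro limI)
  then show "?a \<longlonglongrightarrow> fpt f" "?a e \<le> fpt f" using L by auto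
  have "?a (k + e) \<le> (real (nu f e) + 1) / real (CHAR('a) ^ e)" for k
  proof -
    have "real (nu f (k + e)) \<le> real (CHAR('a) ^ k * (nu f e + 1))"
      using nu_shift_upper[of k e] by (subst of_nat_le_iff) simp
    then show ?thesis using char_pos by (simp add: field_simps power_add)
  qed
  moreover have "(\<lambda>k. ?a (k + e)) \<longlonglongrightarrow> fpt f"
    using \<open>?a \<longlonglongrightarrow> fpt f\<close> by (rule LIMSEQ_ignore_initial_segment)
  ultimately show "fpt f \<le> (real (nu f e) + 1) / real (CHAR('a) ^ e)"
    by (intro LIMSEQ_le_const2) auto
qed

lemma fpt_nonneg: "0 \<le> fpt f"
  using nu_le_fpt[of 0] by (meson divide_nonneg_nonneg of_nat_0_le_iff order_trans)

lemma fpt_le_1: "fpt f \<le> 1"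
  using fpt_le_nu[of 0] nu_less[of 0] by simp

lemma fpt_le: "fpt f \<le> real \<sigma> / real d"
proof (rule LIMSEQ_le_const2[OF tendsto_fpt], intro exI allI impI)
  fix e
  have "real (d * nu f e) \<le> real (CHAR('a) ^ e * \<sigma>)"
    using nu_degree[of e] by (subst of_nat_le_iff) linarith
  then show "real (nu f e) / real (CHAR('a) ^ e) \<le> real \<sigma> / real d"
    using d_pos char_pos by (simp add: field_simps)
qed

text \<open>With \<open>\<nu> = nu f e\<close>, the derivatives of \<open>f ^ (\<nu> + 1)\<close> show that \<open>Jac f\<close> multiplies \<open>f ^ \<nu>\<close> into the Frobenius power.
A monomial \<open>m\<close> of \<open>f ^ \<nu>\<close> survives, and multiplying by its complement \<open>m'\<close> in the socle monomial
still gives a surviving one, so \<open>m'\<close> is not in \<open>Jac f\<close> and has degree less than \<open>t\<close>.\<close>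
lemma nu_degree_lower:
  assumes t: "monomials_in_Jac \<omega> t f" and e: "0 < e" and nd: "\<not> CHAR('a) dvd nu f e + 1"
  shows "CHAR('a) ^ e * \<sigma> < d * nu f e + \<sigma> + t"
proof -
  define \<nu> q where "\<nu> = nu f e" and "q = CHAR('a) ^ e"
  have "CHAR('a) dvd q" using e by (simp add: q_def dvd_power)
  have "f ^ Suc \<nu> \<in> frob_power q" using nu_iff[of "Suc \<nu>" e] by (auto simp: \<nu>_def q_def)
  then have D: "of_nat (Suc \<nu>) * (f ^ \<nu> * mpderiv j f) \<in> frob_power q" for j
    using mpderiv_frob_power[OF _ \<open>CHAR('a) dvd q\<close>] by (metis mpderiv_power)
  define c where "c = (of_nat (Suc \<nu>) :: 'a)"
  have "c \<noteq> 0" using nd by (simp add: c_def \<nu>_def of_nat_eq_0_iff_char_dvd del: of_nat_Suc)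
  have of_nat_c: "of_nat (Suc \<nu>) = (single 0 c :: ('n, 'a) mpoly)" by (simp only: c_def single_of_nat)
  have c: "single 0 (1 / c) * of_nat (Suc \<nu>) = (1 :: ('n, 'a) mpoly)"
    using \<open>c \<noteq> 0\<close> unfolding of_nat_c mult_single by simp
  have D': "mpderiv j f * f ^ \<nu> \<in> frob_power q" for j
  proof -
    have "single 0 (1 / c) * (of_nat (Suc \<nu>) * (f ^ \<nu> * mpderiv j f)) =
        (single 0 (1 / c) * of_nat (Suc \<nu>)) * (mpderiv j f * f ^ \<nu>)"
      by (simp only: mult.assoc mult.commute[of "f ^ \<nu>"])
    then show ?thesis using frob_power_mult[OF D[of j], of "single 0 (1 / c)"] unfolding c by simp
  qed
  have Jac: "g * f ^ \<nu> \<in> frob_power q" if "g \<in> Jac f" for g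
  proof -
    have "g \<in> {g. g * f ^ \<nu> \<in> frob_power q}"
      by (rule ideal_gen_minimal[OF that[unfolded Jac_def]])
         (use D' in \<open>auto simp: frob_power_def ideal_gen_zero ideal_gen_add distrib_right mult.assoc intro: ideal_gen_mult\<close>)
    then show ?thesis by simp
  qed
  have "f ^ \<nu> \<notin> frob_power q" using nu_iff[of \<nu> e] by (simp add: \<nu>_def q_def)
  then obtain m where m: "m \<in> keys (f ^ \<nu>)" "\<And>i. lookup m i < q"
    by (auto simp: frob_power_iff not_le)
  define m' where "m' = Poly_Mapping.Abs_poly_mapping (\<lambda>i. q - 1 - lookup m i)"
  have m': "lookup m' i = q - 1 - lookup m i" for i by (simp add: m'_def)
  have "lookup (single m' 1 * f ^ \<nu>) (m' + m) \<noteq> 0"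
    using m(1) by (simp add: lookup_single_mult in_keys_iff)
  moreover have "lookup (m' + m) i < q" for i using m(2)[of i] by (simp add: lookup_add m')
  ultimately have "single m' 1 * f ^ \<nu> \<notin> frob_power q"
    unfolding frob_power_iff by (metis in_keys_iff not_less)
  then have "single m' 1 \<notin> Jac f" using Jac by blast
  then have "wdeg \<omega> m' < t" using t by (auto simp: monomials_in_Jac_def not_le[symmetric])
  moreover have "wdeg \<omega> (m' + m) + \<sigma> = q * \<sigma>"
  proof -
    note wdeg_plus_sigma
    also have "(\<Sum>i\<in>UNIV. \<omega> i * Suc (lookup (m' + m) i)) = (\<Sum>i\<in>UNIV. \<omega> i * q)"
    proof (intro sum.cong refl)
      fix i show "\<omega> i * Suc (lookup (m' + m) i) = \<omega> i * q" using m(2)[of i] by (simp add: lookup_add m')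
    qed
    finally show ?thesis by (simp add: \<sigma>_def sum_distrib_left mult.commute)
  qed
  ultimately show ?thesis
    using power_keys_wdeg[OF m(1)] by (simp add: wdeg_add q_def \<nu>_def)
qed

text \<open>The shift inequalities confine \<open>nu f (e + 1) + 1\<close> to an interval of length less than the characteristic that contains a
single multiple of it, namely the largest element.\<close>
lemma fpt_eq_if_divisible:
  assumes dvd: "\<And>e. M < e \<Longrightarrow> CHAR('a) dvd nu f e + 1"
  shows "fpt f = (real (nu f M) + 1) / real (CHAR('a) ^ M)"
proof -
  have eq: "nu f (k + M) + 1 = CHAR('a) ^ k * (nu f M + 1)" for k
  proof (induction k)
    case (Suc k)
    from dvd[of "Suc k + M"] obtain c where c: "nu f (Suc k + M) + 1 = CHAR('a) * c" by auto
    have "CHAR('a) * nu f (k + M) \<le> nu f (Suc k + M)"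
      using nu_shift_lower[of 1 "k + M"] by simp
    then have "CHAR('a) * nu f (k + M) < CHAR('a) * c" using c by linarith
    moreover have "CHAR('a) * c \<le> CHAR('a) * (nu f (k + M) + 1)"
      using nu_shift_upper[of 1 "k + M"] c by simp
    ultimately have "nu f (k + M) < c" "c \<le> nu f (k + M) + 1"
      using char_pos by (simp_all only: mult_less_cancel1 mult_le_cancel1)
    then have "c = nu f (k + M) + 1" by linarith
    then show ?case using c Suc by (simp only: power_Suc mult.assoc)
  qed simp
  have "real (nu f (k + M)) / real (CHAR('a) ^ (k + M)) = (real (nu f M) + 1) / real (CHAR('a) ^ M) - (1 / real (CHAR('a) ^ M)) * (1 / real CHAR('a)) ^ k" for k
  proof -
    have "real (nu f (k + M)) + 1 = real CHAR('a) ^ k * (real (nu f M) + 1)"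
      using arg_cong[OF eq[of k], of real] by (simp add: algebra_simps)
    then have "real (nu f (k + M)) = real CHAR('a) ^ k * (real (nu f M) + 1) - 1" by simp
    then have "real (nu f (k + M)) / real (CHAR('a) ^ (k + M)) =
        (real CHAR('a) ^ k * (real (nu f M) + 1) - 1) / real (CHAR('a) ^ (k + M))" by (rule arg_cong)
    also have "\<dots> = (real (nu f M) + 1) / real (CHAR('a) ^ M) - (1 / real (CHAR('a) ^ M)) * (1 / real CHAR('a)) ^ k"
      using char_pos by (simp add: field_simps power_add)
    finally show ?thesis .
  qed
  moreover have "(\<lambda>k. real (nu f (k + M)) / real (CHAR('a) ^ (k + M))) \<longlonglongrightarrow> fpt f"
    using tendsto_fpt by (rule LIMSEQ_ignore_initial_segment)
  ultimately have "(\<lambda>k. (real (nu f M) + 1) / real (CHAR('a) ^ M) - (1 / real (CHAR('a) ^ M)) * (1 / real CHAR('a)) ^ k) \<longlonglongrightarrow> fpt f"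
    by simp
  moreover have "(\<lambda>k. (real (nu f M) + 1) / real (CHAR('a) ^ M) - (1 / real (CHAR('a) ^ M)) * (1 / real CHAR('a)) ^ k)
     \<longlonglongrightarrow> (real (nu f M) + 1) / real (CHAR('a) ^ M) - (1 / real (CHAR('a) ^ M)) * 0"
    using prime_gt_1_nat[OF prime_CHAR] by (intro tendsto_intros LIMSEQ_power_zero) auto
  ultimately show ?thesis using LIMSEQ_unique by fastforce
qed

lemma wdeg_eq_imp_maximal:
  assumes "\<And>i. lookup m i < q" "wdeg \<omega> m + \<sigma> = q * \<sigma>"
  shows "lookup m i = q - 1"
proof (rule ccontr)
  assume ne: "\<not> ?thesis"
  have "(\<Sum>i\<in>UNIV. \<omega> i * Suc (lookup m i)) < (\<Sum>i\<in>UNIV. \<omega> i * q)"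
  proof (rule sum_strict_mono_ex1)
    have "Suc (lookup m i) < q" using ne assms(1)[of i] by linarith
    then show "\<exists>i\<in>UNIV. \<omega> i * Suc (lookup m i) < \<omega> i * q"
      using \<omega>_pos[of i] by (intro bexI[of _ i] mult_strict_left_mono) auto
    show "\<forall>i\<in>UNIV. \<omega> i * Suc (lookup m i) \<le> \<omega> i * q"
      using assms(1) by (intro ballI mult_left_mono) (auto simp: Suc_le_eq)
  qed simp
  moreover have "q * \<sigma> = (\<Sum>i\<in>UNIV. \<omega> i * q)" by (simp add: \<sigma>_def sum_distrib_left mult.commute)
  ultimately show False using assms(2) by (simp add: wdeg_plus_sigma)
qed

text \<open>The hypothesis says that \<open>f ^ nu f e0\<close> has the degree of the socle, so its only surviving monomial is the socle monomial.
Multiplying by Frobenius powers of it never kills anything, which gives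
\<open>nu f (e + e0) \<ge> p\<^sup>e * nu f e0 + nu f e\<close> and, in the limit, \<open>fpt f * (p\<^bsup>e0\<^esup> - 1) \<ge> nu f e0\<close>, with \<open>p\<close> the characteristic.\<close>
lemma fpt_eq_if_socle:
  assumes e0: "0 < e0" and socle: "d * nu f e0 + \<sigma> = CHAR('a) ^ e0 * \<sigma>"
  shows "fpt f = real \<sigma> / real d"
proof -
  define q0 g where "q0 = CHAR('a) ^ e0" and "g = f ^ nu f e0"
  have "g \<notin> frob_power q0" using nu_iff by (simp add: g_def q0_def)
  then obtain c where c: "c \<in> keys g" "\<And>i. lookup c i < q0"
    by (auto simp: frob_power_iff not_le)
  have max: "lookup m i = q0 - 1" if "m \<in> keys g" "\<And>i. lookup m i < q0" for m i
    using that power_keys_wdeg[of m "nu f e0"] socle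
    by (intro wdeg_eq_imp_maximal) (auto simp: g_def q0_def)
  have lower: "CHAR('a) ^ e * nu f e0 + nu f e \<le> nu f (e + e0)" for e
  proof -
    have "g ^ (CHAR('a) ^ e) * f ^ nu f e \<notin> frob_power (CHAR('a) ^ e * q0)"
    proof (rule socle_times_Frobenius[OF prime_CHAR refl _ c(1)])
      show "m = c" if "m \<in> keys g" "\<And>i. lookup m i < q0" for m
        using max[OF that] max[OF c] by (intro poly_mapping_eqI) simp
      show "f ^ nu f e \<notin> frob_power (CHAR('a) ^ e)" by (simp add: nu_iff)
      show "0 < q0" by (simp add: q0_def char_pos)
    qed (rule max[OF c])
    then have "f ^ (CHAR('a) ^ e * nu f e0 + nu f e) \<notin> frob_power (CHAR('a) ^ (e + e0))"
      by (simp add: g_def q0_def power_add mult.commute flip: power_mult)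
    then show ?thesis by (simp only: nu_iff)
  qed
  have q0: "1 < q0" unfolding q0_def using prime_gt_1_nat[OF prime_CHAR] e0 by (rule one_less_power)
  have "real (nu f e0) / q0 + real (nu f e) / real (CHAR('a) ^ e) / q0 \<le> fpt f" for e
  proof -
    have "real (CHAR('a) ^ e * nu f e0 + nu f e) / real (CHAR('a) ^ (e + e0)) \<le> real (nu f (e + e0)) / real (CHAR('a) ^ (e + e0))"
      by (rule divide_right_mono) (use lower[of e] in \<open>simp_all only: of_nat_le_iff of_nat_0_le_iff\<close>)
    also have "\<dots> \<le> fpt f" by (rule nu_le_fpt)
    finally show ?thesis using char_pos by (simp add: q0_def power_add field_simps)
  qed
  moreover have "(\<lambda>e. real (nu f e0) / q0 + real (nu f e) / real (CHAR('a) ^ e) / q0) \<longlonglongrightarrow> real (nu f e0) / q0 + fpt f / q0"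
    using q0 by (intro tendsto_intros tendsto_fpt) auto
  ultimately have "real (nu f e0) / q0 + fpt f / q0 \<le> fpt f"
    by (intro LIMSEQ_le_const2) auto
  then have "real (nu f e0) \<le> fpt f * (real q0 - 1)" using q0 by (simp add: field_simps)
  then have "real d * real (nu f e0) \<le> real d * (fpt f * (real q0 - 1))" by (rule mult_left_mono) simp
  moreover have "real d * real (nu f e0) + real \<sigma> = real q0 * real \<sigma>"
    using arg_cong[OF socle, of real] by (simp add: q0_def)
  ultimately have "real \<sigma> * (real q0 - 1) \<le> (real d * fpt f) * (real q0 - 1)"
    by (simp add: algebra_simps)
  then have "real \<sigma> \<le> real d * fpt f" using q0 by simp
  then have "real \<sigma> / real d \<le> fpt f" using d_pos by (simp add: field_simps)
  then show ?thesis using fpt_le by simp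
qed

text \<open>Suppose that \<open>CHAR('a)\<close> fails to divide \<open>nu f e + 1\<close> for some \<open>e > e0 + t\<close>, so that the gap at \<open>e\<close> is less than \<open>t\<close>.
If \<open>\<sigma>\<close> exceeded \<open>d\<close>, then \<open>nu f e < p\<^sup>e\<close> would make the gap at least \<open>p\<^sup>e - 1 \<ge> t\<close>, with \<open>p\<close> the characteristic. So
\<open>\<sigma> \<le> d\<close>. Dividing by \<open>Q = p\<^bsup>e-e0\<^esup> > t\<close> turns the bound at \<open>e\<close> into \<open>p\<^bsup>e0\<^esup> * \<sigma> \<le> d * (nu f e0 + 1)\<close>, that is,
the gap at \<open>e0\<close> is at most \<open>d - \<sigma>\<close>. As \<open>p\<^bsup>e0\<^esup> - 1 = d * k\<close>, this gap is a multiple of \<open>d\<close>, so it vanishes.\<close>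
lemma fpt_cases:
  assumes t: "monomials_in_Jac \<omega> t f" and e0: "0 < e0" "CHAR('a) ^ e0 = 1 + d * k"
  shows "fpt f = real \<sigma> / real d \<or> fpt f = (real (nu f (e0 + t)) + 1) / real (CHAR('a) ^ (e0 + t))"
proof (cases "\<exists>e > e0 + t. \<not> CHAR('a) dvd nu f e + 1")
  case False
  then show ?thesis using fpt_eq_if_divisible[of "e0 + t"] by blast
next
  case True
  then obtain e where e: "e0 + t < e" "\<not> CHAR('a) dvd nu f e + 1" by blast
  have lo: "CHAR('a) ^ e * \<sigma> < d * nu f e + \<sigma> + t"
    using nu_degree_lower[OF t _ e(2)] e(1) by simp
  have big: "a < CHAR('a) ^ a" for a using prime_gt_1_nat[OF prime_CHAR] by (simp add: power_gt_expt)
  have "\<sigma> \<le> d"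
  proof (rule ccontr)
    assume "\<not> ?thesis"
    then obtain x where x: "\<sigma> = d + 1 + x" by (metis Suc_eq_plus1 add.assoc add.commute less_imp_Suc_add not_le plus_1_eq_Suc)
    have "d * (nu f e + 1) \<le> d * CHAR('a) ^ e" using nu_less[of e] by (intro mult_left_mono) auto
    moreover have "1 * x \<le> CHAR('a) ^ e * x"
      using char_pos by (intro mult_right_mono) (auto simp: Suc_le_eq)
    moreover have "t + 1 \<le> CHAR('a) ^ e" using big[of e] e(1) by linarith
    moreover have "CHAR('a) ^ e * \<sigma> = d * CHAR('a) ^ e + CHAR('a) ^ e + CHAR('a) ^ e * x"
      "d * (nu f e + 1) = d * nu f e + d"
      by (simp_all add: x algebra_simps)
    ultimately show False using lo x by linarith
  qed
  define Q where "Q = CHAR('a) ^ (e - e0)"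
  have Q: "t < Q" unfolding Q_def using big[of "e - e0"] e(1) by linarith
  have pe: "CHAR('a) ^ e = Q * CHAR('a) ^ e0" unfolding Q_def using e(1) by (simp flip: power_add)
  have "nu f e + 1 \<le> Q * (nu f e0 + 1)"
    using nu_shift_upper[of "e - e0" e0] e(1) by (simp add: Q_def)
  then have "d * (nu f e + 1) \<le> d * (Q * (nu f e0 + 1))" by (rule mult_left_mono) simp
  \<comment> \<open>The final summand 1 absorbs the gap: it contributes \<open>Q\<close>, which is larger than \<open>t\<close>.\<close>
  then have "Q * (CHAR('a) ^ e0 * \<sigma>) < Q * (d * (nu f e0 + 1) + 1)"
    using lo \<open>\<sigma> \<le> d\<close> Q by (simp add: pe algebra_simps)
  then have "CHAR('a) ^ e0 * \<sigma> < d * (nu f e0 + 1) + 1" by (simp only: mult_less_cancel1)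
  then have "CHAR('a) ^ e0 * \<sigma> \<le> d * (nu f e0 + 1)" by simp
  then have "d * (k * \<sigma>) < d * (nu f e0 + 1)"
    using sigma_pos by (simp add: e0(2) algebra_simps)
  then have "k * \<sigma> < nu f e0 + 1" by (simp only: mult_less_cancel1)
  then have "k * \<sigma> \<le> nu f e0" by simp
  then have "d * (k * \<sigma>) \<le> d * nu f e0" by (rule mult_left_mono) simp
  then have "d * nu f e0 + \<sigma> = CHAR('a) ^ e0 * \<sigma>"
    using nu_degree[of e0] d_pos by (simp add: e0(2) algebra_simps)
  then show ?thesis using fpt_eq_if_socle[OF e0(1)] by blast
qed

end

lemma W_quasi_homogeneous:
  assumes "f \<in> W \<omega>" "CHAR('a::field) > 0" "\<And>i. 0 < \<omega> i"
  shows "\<exists>d. quasi_homogeneous (f :: ('n::finite, 'a) mpoly) \<omega> d \<and> \<not> CHAR('a) dvd d"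
proof -
  obtain d where d: "whomogeneous \<omega> d f" "\<not> CHAR('a) dvd d" using assms(1) by (auto simp: W_def)
  then have "0 < d" by (metis dvd_0_right gr0I)
  then show ?thesis using d assms by (auto simp: quasi_homogeneous_def)
qed

section \<open>Finiteness and the ascending chain condition\<close>

lemma finite_fpt_fixed_degree:
  fixes \<omega> :: "'n::finite \<Rightarrow> nat"
  assumes char: "CHAR('a::field) > 0" and \<omega>: "\<And>i. 0 < \<omega> i"
  shows "finite {fpt f |f :: ('n, 'a) mpoly. f \<in> W \<omega> \<and> quasi_homogeneous f \<omega> d \<and> \<not> CHAR('a) dvd d}"
proof (cases "0 < d \<and> \<not> CHAR('a) dvd d")
  case False
  then have "{fpt f |f :: ('n, 'a) mpoly. f \<in> W \<omega> \<and> quasi_homogeneous f \<omega> d \<and> \<not> CHAR('a) dvd d} = {}"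
    by (auto simp: quasi_homogeneous_def)
  then show ?thesis by (simp only: finite.emptyI)
next
  case True
  let ?p = "CHAR('a)"
  have "coprime ?p d" using True prime_CHAR_semidom[OF char] prime_imp_coprime by blast
  then obtain e0 k where e0: "0 < e0" "?p ^ e0 = 1 + d * k"
    using ex_power_congruent_1[of ?p d] True char by blast
  obtain t where t: "\<And>f :: ('n, 'a) mpoly. whomogeneous \<omega> d f \<Longrightarrow> \<exists>t'. monomials_in_Jac \<omega> t' f \<Longrightarrow>
      monomials_in_Jac \<omega> t f"
    using uniform_monomials_in_Jac[where \<omega> = \<omega> and d = d, OF \<omega>] by blast
  define M where "M = e0 + t"
  have "fpt f \<in> insert (real (\<Sum>i\<in>UNIV. \<omega> i) / real d) ((\<lambda>c. (real c + 1) / real (?p ^ M)) ` {..<?p ^ M})"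
    if f: "f \<in> W \<omega>" "quasi_homogeneous f \<omega> d" for f :: "('n, 'a) mpoly"
  proof -
    interpret quasi_homogeneous f \<omega> d by (rule f(2))
    have "monomials_in_Jac \<omega> t f" using t[OF homogeneous] W_monomials_in_Jac[OF f(1) \<omega>] by blast
    then show ?thesis using fpt_cases[OF _ e0] nu_less[of M] by (auto simp: M_def \<sigma>_def)
  qed
  then have "{fpt f |f :: ('n, 'a) mpoly. f \<in> W \<omega> \<and> quasi_homogeneous f \<omega> d \<and> \<not> CHAR('a) dvd d} \<subseteq>
    insert (real (\<Sum>i\<in>UNIV. \<omega> i) / real d) ((\<lambda>c. (real c + 1) / real (?p ^ M)) ` {..<?p ^ M})"
    by blast
  then show ?thesis by (rule finite_subset) simp
qed

text \<open>Since \<open>\<mu> < fpt f \<le> \<sigma> / d\<close> and \<open>\<sigma>\<close> is at most \<open>N\<close> times the number of variables, the degree \<open>d\<close> is bounded.\<close>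
lemma finite_fpt_above:
  fixes N :: nat and \<mu> :: real
  assumes char: "CHAR('a::field) > 0" and \<mu>: "0 < \<mu>"
  shows "finite (fpt ` (W_upto N :: ('n::finite, 'a) mpoly set) \<inter> {\<mu><..})"
proof -
  define Om where "Om = {\<omega> :: 'n \<Rightarrow> nat. \<forall>i. 0 < \<omega> i \<and> \<omega> i \<le> N}"
  define D where "D = nat \<lceil>real (card (UNIV :: 'n set) * N) / \<mu>\<rceil>"
  let ?V = "\<lambda>\<omega> d. {fpt f |f :: ('n, 'a) mpoly. f \<in> W \<omega> \<and> quasi_homogeneous f \<omega> d \<and> \<not> CHAR('a) dvd d}"
  have "Om \<subseteq> {\<omega>. \<forall>i. (i \<in> UNIV \<longrightarrow> \<omega> i \<in> {..N}) \<and> (i \<notin> UNIV \<longrightarrow> \<omega> i = 0)}" by (auto simp: Om_def)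
  then have "finite Om" by (rule finite_subset) (rule finite_set_of_finite_funs, auto)
  then have "finite (\<Union>\<omega>\<in>Om. \<Union>d\<in>{..D}. ?V \<omega> d)"
    using finite_fpt_fixed_degree[OF char] by (intro finite_UN_I) (auto simp: Om_def)
  moreover have "fpt f \<in> (\<Union>\<omega>\<in>Om. \<Union>d\<in>{..D}. ?V \<omega> d)" 
    if f: "f \<in> W_upto N" "\<mu> < fpt f" for f :: "('n, 'a) mpoly"
  proof -
    obtain \<omega> where \<omega>: "\<omega> \<in> Om" "f \<in> W \<omega>" using f(1) by (auto simp: W_upto_def Om_def)
    then obtain d where d: "quasi_homogeneous f \<omega> d" "\<not> CHAR('a) dvd d"
      using W_quasi_homogeneous[OF \<omega>(2) char] by (auto simp: Om_def)
    interpret quasi_homogeneous f \<omega> d by (rule d(1))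
    have "\<sigma> \<le> card (UNIV :: 'n set) * N" unfolding \<sigma>_def 
      using sum_bounded_above[of UNIV \<omega> N] \<omega>(1) by (auto simp: Om_def)
    then have "real \<sigma> \<le> real (card (UNIV :: 'n set) * N)" by (simp only: of_nat_le_iff)
    moreover have "\<mu> < real \<sigma> / real d" using f(2) fpt_le by (rule less_le_trans)
    then have "\<mu> * real d < real \<sigma>" using d_pos by (simp add: pos_less_divide_eq)
    ultimately have "real d \<le> real (card (UNIV :: 'n set) * N) / \<mu>" using \<mu> by (simp add: field_simps)
    then have "d \<le> D" unfolding D_def by linarith
    then show ?thesis using \<omega> d by blast
  qed
  ultimately show ?thesis by (elim finite_subset[rotated]) blast
qed

lemma fpt_W_upto_bounds:
  assumes "CHAR('a::field) > 0" "f \<in> (W_upto N :: ('n::finite, 'a) mpoly set)"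
  shows "0 \<le> fpt f" "fpt f \<le> 1"
proof -
  obtain \<omega> where \<omega>: "\<And>i. 0 < \<omega> i" "f \<in> W \<omega>" using assms(2) by (auto simp: W_upto_def)
  then obtain d where "quasi_homogeneous f \<omega> d" using W_quasi_homogeneous[OF \<omega>(2) assms(1)] by blast
  then interpret quasi_homogeneous f \<omega> d .
  show "0 \<le> fpt f" "fpt f \<le> 1" by (rule fpt_nonneg, rule fpt_le_1)
qed

theorem proposition7p3:
  fixes N :: nat
  assumes "CHAR('l::field) > 0"
  shows "(\<forall>\<mu>::real. 0 < \<mu> \<and> \<mu> \<le> 1 \<longrightarrow>
            finite (fpt ` (W_upto N :: ('n::finite, 'l) mpoly set) \<inter> {\<mu><..1}))
       \<and> (\<nexists>s :: nat \<Rightarrow> real. strict_mono s \<and>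
            range s \<subseteq> fpt ` (W_upto N :: ('n, 'l) mpoly set))"
proof (intro conjI allI impI notI)
  fix \<mu> :: real assume "0 < \<mu> \<and> \<mu> \<le> 1"
  then show "finite (fpt ` (W_upto N :: ('n, 'l) mpoly set) \<inter> {\<mu><..1})"
    by (intro finite_subset[OF _ finite_fpt_above[OF assms, of \<mu> N]]) auto
next
  assume "\<exists>s :: nat \<Rightarrow> real. strict_mono s \<and> range s \<subseteq> fpt ` (W_upto N :: ('n, 'l) mpoly set)"
  then obtain s :: "nat \<Rightarrow> real" where s: "strict_mono s" "range s \<subseteq> fpt ` (W_upto N :: ('n, 'l) mpoly set)"
    by blast
  have "0 \<le> s 0" using s(2) fpt_W_upto_bounds(1)[OF assms] by (auto dest!: range_subsetD[of s _ 0])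
  then have "0 < s 1" using strict_monoD[OF s(1), of 0 1] by simp
  then have "finite (fpt ` (W_upto N :: ('n, 'l) mpoly set) \<inter> {s 1<..})"
    by (rule finite_fpt_above[OF assms])
  moreover have "s ` {2..} \<subseteq> fpt ` (W_upto N :: ('n, 'l) mpoly set) \<inter> {s 1<..}"
    using s strict_monoD[OF s(1), of 1] by auto
  ultimately have "finite (s ` {2..})" by (rule finite_subset[rotated])
  then have "finite {2::nat..}" using strict_mono_imp_inj_on[OF s(1)] by (auto dest!: finite_imageD intro: inj_on_subset)
  then show False using infinite_Ici by blast
qed

end
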